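(* Let $0\le\alpha\le\frac12$ and $n\ge5$. Among all strongly connected digraphs of order $n$, the digraphs $\theta(0,1,n-3)$, $\theta(1,1,n-4)$ and $\theta(0,2,n-4)$ attain the second, the third and the fourth minimum $A_\alpha$ spectral radius, respectively (the minimum being attained uniquely by the directed cycle $C_n$).
   Context: All digraphs are simple. For a digraph $G$, $A(G)$ is its adjacency matrix and $D(G)$ the diagonal matrix of outdegrees; $A_\alpha(G)=\alpha D(G)+(1-\alpha)A(G)$ and $\lambda_\alpha(G)$ is the largest modulus of an eigenvalue of $A_\alpha(G)$. For integers $a,b,c\ge0$ with $a+b+c+2=n$, $\theta(a,b,c)$ is the digraph with two vertices $u,v$, two internally disjoint directed paths from $v$ to $u$ with $a$ and $b$ internal vertices, and a directed path from $u$ to $v$ with $c$ internal vertices, internally disjoint from the other two. *)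

theory Defs
  imports "Graph_Theory.Graph_Theory" "Jordan_Normal_Form.Spectral_Radius"
begin

text \<open>A simple digraph (finite, no loops, no parallel arcs; opposite arcs are allowed) is a
  \<^locale>\<open>pair_digraph\<close>.  Its matrices are taken with respect to the increasing
  enumeration of its vertices; another enumeration gives a similar matrix.\<close>

definition order_of :: "nat pair_pre_digraph \<Rightarrow> nat" where
  "order_of G = card (pverts G)"

definition vertex :: "nat pair_pre_digraph \<Rightarrow> nat \<Rightarrow> nat" where
  "vertex G i = sorted_list_of_set (pverts G) ! i"

definition adjacency_matrix :: "nat pair_pre_digraph \<Rightarrow> complex mat" where
  "adjacency_matrix G = mat (order_of G) (order_of G)
     (\<lambda>(i, j). if (vertex G i, vertex G j) \<in> parcs G then 1 else 0)"

definition outdegree_matrix :: "nat pair_pre_digraph \<Rightarrow> complex mat" where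
  "outdegree_matrix G = mat (order_of G) (order_of G)
     (\<lambda>(i, j). if i = j then of_nat (out_degree (with_proj G) (vertex G i)) else 0)"

definition A_alpha :: "real \<Rightarrow> nat pair_pre_digraph \<Rightarrow> complex mat" where
  "A_alpha \<alpha> G = complex_of_real \<alpha> \<cdot>\<^sub>m outdegree_matrix G
                 + complex_of_real (1 - \<alpha>) \<cdot>\<^sub>m adjacency_matrix G"

definition lambda_alpha :: "real \<Rightarrow> nat pair_pre_digraph \<Rightarrow> real" where
  "lambda_alpha \<alpha> G = spectral_radius (A_alpha \<alpha> G)"

definition strong_digraphs :: "nat \<Rightarrow> nat pair_pre_digraph set" where
  "strong_digraphs n =
     {G. pair_digraph G \<and> strongly_connected (with_proj G) \<and> order_of G = n}"

definition dicycle :: "nat \<Rightarrow> nat pair_pre_digraph" where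
  "dicycle n = \<lparr> pverts = {0..<n}, parcs = {(i, Suc i mod n) | i. i < n} \<rparr>"

definition path_arcs :: "'a list \<Rightarrow> 'a rel" where
  "path_arcs xs = set (zip xs (tl xs))"

text \<open>Here \<open>v\<close> is vertex 0 and \<open>u\<close> is vertex 1.  For \<open>a = b = 0\<close> the two parallel arcs
  from \<open>v\<close> to \<open>u\<close> collapse to one; that case is not a simple digraph and is never used.\<close>

definition theta :: "nat \<Rightarrow> nat \<Rightarrow> nat \<Rightarrow> nat pair_pre_digraph" where
  "theta a b c =
     \<lparr> pverts = {0..<a + b + c + 2},
       parcs = path_arcs (0 # [2..<a + 2] @ [1])
             \<union> path_arcs (0 # [a + 2..<a + b + 2] @ [1])
             \<union> path_arcs (1 # [a + b + 2..<a + b + c + 2] @ [0]) \<rparr>"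

text \<open>The value of \<open>f\<close> at \<open>x\<close> is the \<open>k\<close>-th smallest among the distinct values of
  \<open>f\<close> on \<open>S\<close>; \<open>k = 1\<close> is the minimum.\<close>

definition attains_kth_min :: "('a \<Rightarrow> real) \<Rightarrow> 'a set \<Rightarrow> nat \<Rightarrow> 'a \<Rightarrow> bool" where
  "attains_kth_min f S k x \<longleftrightarrow>
     x \<in> S \<and> finite {r \<in> f ` S. r < f x} \<and> card {r \<in> f ` S. r < f x} + 1 = k"

end

theory Submission
  imports Defs
begin

text \<open>For a nonnegative matrix \<open>A\<close>, a nonzero \<open>x \<ge> 0\<close> with \<open>A x \<ge> \<mu> x\<close> forces the spectral
  radius to be at least \<open>\<mu>\<close>, and a positive \<open>x\<close> with \<open>A x \<le> \<mu> x\<close> forces it to be at most \<open>\<mu>\<close>.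
  Put \<open>\<beta> = \<alpha> / (1 - \<alpha>)\<close> and write radii as \<open>\<alpha> + (1 - \<alpha>) s\<close>.  If a vertex \<open>v\<close> has two
  out-neighbours at distances \<open>p\<close> and \<open>q\<close> to \<open>v\<close>, the vector \<open>x z = s\<close> to the power \<open>- dist z v\<close>
  shows that the radius is at least the one given by the root of \<open>s - \<beta> = (1/s)^p + (1/s)^q\<close>,
  with equality if all other vertices have outdegree 1.  The digraphs \<open>\<theta>(0,1,n-3)\<close>,
  \<open>\<theta>(1,1,n-4)\<close>, \<open>\<theta>(0,2,n-4)\<close> realize \<open>{p, q} = {n-2, n-1}, {n-2}, {n-3, n-1}\<close>.
  A digraph of radius below that of \<open>\<theta>(0,2,n-4)\<close> therefore has \<open>p, q \<ge> n - 2\<close> at every branching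
  vertex.  The distance levels towards \<open>v\<close> then contain one vertex each, except possibly for a
  pair at the last level, so that the arcs are almost determined: either there is no
  branching vertex besides \<open>v\<close>, or the digraph contains a Hamiltonian cycle with two consecutive
  shortcuts, and a modified test vector excludes that case.\<close>

section \<open>Spectral radius of nonnegative matrices\<close>

text \<open>Take an eigenvector \<open>v\<close> for an eigenvalue \<open>e\<close> of largest
  modulus and the least \<open>m\<close> such that the moduli of \<open>v\<close> stay below
  \<open>m * x\<close>. Equality holds in some row \<open>k\<close>, and that row of the eigenvalue
  equation gives \<open>norm e \<le> \<mu>\<close>.\<close>

lemma spectral_radius_leI:
  fixes A :: "complex mat" and a :: "nat \<Rightarrow> nat \<Rightarrow> real" and x :: "nat \<Rightarrow> real"
  assumes A: "A \<in> carrier_mat n n" and n: "n > 0"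
    and entries: "\<And>i j. i < n \<Longrightarrow> j < n \<Longrightarrow> A $$ (i, j) = of_real (a i j)"
    and nonneg: "\<And>i j. i < n \<Longrightarrow> j < n \<Longrightarrow> a i j \<ge> 0"
    and pos: "\<And>i. i < n \<Longrightarrow> x i > 0"
    and le: "\<And>i. i < n \<Longrightarrow> (\<Sum>j<n. a i j * x j) \<le> \<mu> * x i"
  shows "spectral_radius A \<le> \<mu>"
proof -
  obtain e where e: "eigenvalue A e" and sr: "spectral_radius A = norm e"
    using spectral_radius_mem_max(1)[OF A n] by (auto simp: spectrum_def)
  then obtain v where v: "v \<in> carrier_vec n" "v \<noteq> 0\<^sub>v n" "A *\<^sub>v v = e \<cdot>\<^sub>v v"
    using A by (auto simp: eigenvalue_def eigenvector_def)
  define m where "m = Max ((\<lambda>i. norm (v $ i) / x i) ` {..<n})"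
  have "m \<in> (\<lambda>i. norm (v $ i) / x i) ` {..<n}"
    unfolding m_def by (rule Max_in) (use n in auto)
  then obtain k where k: "k < n" and mk: "m = norm (v $ k) / x k" by auto
  have ub: "norm (v $ i) \<le> m * x i" if "i < n" for i
  proof -
    have "norm (v $ i) / x i \<le> m" unfolding m_def by (rule Max_ge) (use that in auto)
    then show ?thesis using pos[OF that] by (simp add: field_simps)
  qed
  obtain l where l: "l < n" "v $ l \<noteq> 0"
    using v(1,2) by (metis carrier_vecD eq_vecI index_zero_vec(1) index_zero_vec(2))
  have "0 < norm (v $ l)" using l by simp
  also have "\<dots> \<le> m * x l" using ub l by blast
  finally have m: "m > 0" using pos[OF l(1)] by (simp add: zero_less_mult_iff)
  have "norm e * norm (v $ k) = norm ((A *\<^sub>v v) $ k)"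
    using v k by (simp add: norm_mult)
  also have "(A *\<^sub>v v) $ k = (\<Sum>j<n. of_real (a k j) * v $ j)"
    using A v(1) k entries by (simp add: scalar_prod_def lessThan_atLeast0)
  also have "norm \<dots> \<le> (\<Sum>j<n. norm (of_real (a k j) * v $ j))" by (rule norm_sum)
  also have "\<dots> \<le> (\<Sum>j<n. a k j * (m * x j))"
    using nonneg k ub by (intro sum_mono) (auto simp: norm_mult intro!: mult_left_mono)
  also have "\<dots> = m * (\<Sum>j<n. a k j * x j)"
    by (simp add: sum_distrib_left algebra_simps)
  also have "\<dots> \<le> m * (\<mu> * x k)" using le[OF k] m by (intro mult_left_mono) auto
  also have "\<dots> = \<mu> * norm (v $ k)" using mk pos[OF k] by simp
  finally have *: "norm e * norm (v $ k) \<le> \<mu> * norm (v $ k)" .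
  have "norm (v $ k) > 0" using mk m pos[OF k] by (auto simp: field_simps)
  with * show ?thesis using sr by simp
qed

text \<open>If \<open>B x \<ge> q x\<close> then also \<open>B (B x) \<ge> q (B x)\<close>, so the induction generalizes over \<open>x\<close>.\<close>

lemma mat_power_subinvariant:
  fixes B :: "complex mat" and b :: "nat \<Rightarrow> nat \<Rightarrow> real" and x :: "nat \<Rightarrow> real"
  assumes B: "B \<in> carrier_mat n n"
    and entries: "\<And>i j. i < n \<Longrightarrow> j < n \<Longrightarrow> B $$ (i, j) = of_real (b i j)"
    and nonneg: "\<And>i j. i < n \<Longrightarrow> j < n \<Longrightarrow> b i j \<ge> 0"
    and q: "q \<ge> 0"
    and le: "\<And>i. i < n \<Longrightarrow> q * x i \<le> (\<Sum>j<n. b i j * x j)"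
    and i: "i < n"
  shows "q ^ k * x i \<le> norm ((B ^\<^sub>m k *\<^sub>v vec n (\<lambda>i. of_real (x i))) $ i)"
  using le
proof (induction k arbitrary: x)
  case 0
  then show ?case using B i by simp
next
  case (Suc k)
  define y where "y i = (\<Sum>j<n. b i j * x j)" for i
  have BX: "B *\<^sub>v vec n (\<lambda>i. of_real (x i)) = vec n (\<lambda>i. of_real (y i))"
    using B entries by (intro eq_vecI) (auto simp: y_def scalar_prod_def lessThan_atLeast0)
  have y: "q * y i \<le> (\<Sum>j<n. b i j * y j)" if "i < n" for i
  proof -
    have "q * y i = (\<Sum>j<n. b i j * (q * x j))"
      by (simp add: y_def sum_distrib_left algebra_simps)
    also have "\<dots> \<le> (\<Sum>j<n. b i j * y j)"
      using Suc.prems nonneg that by (intro sum_mono mult_left_mono) (auto simp: y_def)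
    finally show ?thesis .
  qed
  have "q ^ Suc k * x i = q ^ k * (q * x i)" by simp
  also have "\<dots> \<le> q ^ k * y i"
    using Suc.prems[OF i] q by (intro mult_left_mono) (auto simp: y_def)
  also have "\<dots> \<le> norm ((B ^\<^sub>m k *\<^sub>v vec n (\<lambda>i. of_real (y i))) $ i)"
    using y by (rule Suc.IH)
  also have "B ^\<^sub>m k *\<^sub>v vec n (\<lambda>i. of_real (y i)) = B ^\<^sub>m Suc k *\<^sub>v vec n (\<lambda>i. of_real (x i))"
    using B by (simp add: BX[symmetric] assoc_mult_mat_vec[of _ n n _ n])
  finally show ?case .
qed

text \<open>If \<open>\<mu>\<close> exceeded the spectral radius, dividing by some
  \<open>\<nu>\<close> strictly between them would give \<open>B\<close> of spectral radius below 1,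
  whose powers are bounded entrywise by one constant. But entry \<open>k\<close> of the
  \<open>l\<close>-th power of \<open>B\<close> applied to \<open>x\<close> has modulus at least
  \<open>(\<mu> / \<nu>) ^ l * x k\<close>, which is unbounded.\<close>

lemma spectral_radius_geI:
  fixes A :: "complex mat" and a :: "nat \<Rightarrow> nat \<Rightarrow> real" and x :: "nat \<Rightarrow> real"
  assumes A: "A \<in> carrier_mat n n"
    and entries: "\<And>i j. i < n \<Longrightarrow> j < n \<Longrightarrow> A $$ (i, j) = of_real (a i j)"
    and nonneg: "\<And>i j. i < n \<Longrightarrow> j < n \<Longrightarrow> a i j \<ge> 0"
    and k: "k < n" "x k > 0"
    and le: "\<And>i. i < n \<Longrightarrow> \<mu> * x i \<le> (\<Sum>j<n. a i j * x j)"
  shows "\<mu> \<le> spectral_radius A"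
proof (rule ccontr)
  assume "\<not> \<mu> \<le> spectral_radius A"
  moreover have sr0: "spectral_radius A \<ge> 0"
    using spectral_radius_mem_max(1)[OF A] k by auto
  ultimately obtain \<nu> where \<nu>: "spectral_radius A < \<nu>" "\<nu> < \<mu>"
    using dense[of "spectral_radius A" \<mu>] by auto
  with sr0 have \<nu>0: "\<nu> > 0" by simp
  define B where "B = complex_of_real (1 / \<nu>) \<cdot>\<^sub>m A"
  have B: "B \<in> carrier_mat n n" using A by (simp add: B_def)
  obtain e where e: "eigenvalue B e" and srB: "spectral_radius B = norm e"
    using spectral_radius_mem_max(1)[OF B] k by (auto simp: spectrum_def)
  then obtain v where v: "v \<in> carrier_vec n" "v \<noteq> 0\<^sub>v n" "B *\<^sub>v v = e \<cdot>\<^sub>v v"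
    using B by (auto simp: eigenvalue_def eigenvector_def)
  have "A = complex_of_real \<nu> \<cdot>\<^sub>m B" using \<nu>0 A by (intro eq_matI) (auto simp: B_def)
  then have "A *\<^sub>v v = complex_of_real \<nu> \<cdot>\<^sub>v (B *\<^sub>v v)"
    using B v(1) by (auto simp: scalar_prod_def sum_distrib_left mult.assoc)
  also have "\<dots> = (of_real \<nu> * e) \<cdot>\<^sub>v v" using v by (simp add: smult_smult_assoc)
  finally have "eigenvalue A (of_real \<nu> * e)"
    using v A by (auto simp: eigenvalue_def eigenvector_def)
  then have "norm (of_real \<nu> * e) \<le> spectral_radius A"
    using spectral_radius_mem_max(2)[OF A] k by (auto simp: spectrum_def)
  moreover have "norm (of_real \<nu> * e) = \<nu> * norm e" using \<nu>0 by (simp add: norm_mult)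
  ultimately have "\<nu> * norm e < \<nu>" using \<nu> by linarith
  then have "spectral_radius B < 1" using \<nu>0 srB by simp
  then obtain c where c: "\<And>l. norm_bound (B ^\<^sub>m l) c"
    using spectral_radius_jnf_norm_bound_less_1_upper_triangular[OF B] by auto
  define K where "K = (\<Sum>j<n. c * \<bar>x j\<bar>)"
  have bound: "(\<mu> / \<nu>) ^ l * x k \<le> K" for l
  proof -
    have Bl: "B ^\<^sub>m l \<in> carrier_mat n n" using B by simp
    have "(\<mu> / \<nu>) ^ l * x k \<le> norm ((B ^\<^sub>m l *\<^sub>v vec n (\<lambda>i. of_real (x i))) $ k)"
    proof (rule mat_power_subinvariant[where b = "\<lambda>i j. a i j / \<nu>", OF B])
      show "\<And>i. i < n \<Longrightarrow> \<mu> / \<nu> * x i \<le> (\<Sum>j<n. a i j / \<nu> * x j)"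
        using le \<nu>0 by (simp add: sum_divide_distrib[symmetric] divide_right_mono)
    qed (use A entries nonneg \<nu> \<nu>0 k in \<open>auto simp: B_def\<close>)
    also have "(B ^\<^sub>m l *\<^sub>v vec n (\<lambda>i. of_real (x i))) $ k
      = (\<Sum>j<n. (B ^\<^sub>m l) $$ (k, j) * of_real (x j))"
      using carrier_matD[OF Bl] carrier_matD[OF B] k by (simp add: scalar_prod_def lessThan_atLeast0)
    also have "norm \<dots> \<le> (\<Sum>j<n. norm ((B ^\<^sub>m l) $$ (k, j) * of_real (x j)))" by (rule norm_sum)
    also have "\<dots> \<le> K"
      unfolding K_def using c[of l] carrier_matD[OF B] k
      by (intro sum_mono) (auto simp: norm_mult norm_bound_def intro!: mult_right_mono)
    finally show ?thesis .
  qed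
  have "\<mu> / \<nu> > 1" using \<nu> \<nu>0 by simp
  then obtain l where "K / x k < (\<mu> / \<nu>) ^ l" using real_arch_pow by blast
  then have "K < (\<mu> / \<nu>) ^ l * x k" using k by (simp add: field_simps)
  with bound[of l] show False by simp
qed

section \<open>Test vectors on the vertices of a digraph\<close>

lemma out_degree_with_proj: "out_degree (with_proj G) z = card (parcs G `` {z})"
proof -
  have "out_arcs (with_proj G) z = Pair z ` (parcs G `` {z})"
    by (auto simp: out_arcs_def)
  then show ?thesis by (simp add: out_degree_def card_image inj_on_def)
qed

lemma bij_betw_vertex:
  assumes "finite (pverts G)"
  shows "bij_betw (vertex G) {..<order_of G} (pverts G)"
  using assms bij_betw_nth[of "sorted_list_of_set (pverts G)" "{..<order_of G}"]
  by (simp add: vertex_def[abs_def] order_of_def)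

text \<open>Entries of \<open>A_alpha\<close> addressed by vertices instead of positions in the
  enumeration, so that test vectors can be functions on vertices.\<close>

definition weight :: "real \<Rightarrow> nat pair_pre_digraph \<Rightarrow> nat \<Rightarrow> nat \<Rightarrow> real" where
  "weight \<alpha> G z w = \<alpha> * (if z = w then real (card (parcs G `` {z})) else 0)
     + (1 - \<alpha>) * (if (z, w) \<in> parcs G then 1 else 0)"

lemma A_alpha_carrier: "A_alpha \<alpha> G \<in> carrier_mat (order_of G) (order_of G)"
  by (simp add: A_alpha_def outdegree_matrix_def adjacency_matrix_def)

lemma A_alpha_index:
  assumes "finite (pverts G)" "i < order_of G" "j < order_of G"
  shows "A_alpha \<alpha> G $$ (i, j) = of_real (weight \<alpha> G (vertex G i) (vertex G j))"
proof -
  have "vertex G i = vertex G j \<longleftrightarrow> i = j"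
    using bij_betw_vertex[OF assms(1)] assms(2,3) by (auto simp: bij_betw_def inj_on_def)
  then show ?thesis using assms
    by (auto simp: A_alpha_def outdegree_matrix_def adjacency_matrix_def weight_def
        out_degree_with_proj)
qed

lemma sum_weight:
  fixes x :: "nat \<Rightarrow> real"
  assumes "pair_digraph G" "z \<in> pverts G"
  shows "(\<Sum>j<order_of G. weight \<alpha> G z (vertex G j) * x (vertex G j))
    = \<alpha> * real (card (parcs G `` {z})) * x z + (1 - \<alpha>) * (\<Sum>w\<in>parcs G `` {z}. x w)"
proof -
  interpret pair_digraph G by fact
  have fin: "finite (pverts G)" by (rule pair_finite_verts)
  have sub: "parcs G `` {z} \<subseteq> pverts G" by (auto dest: in_arcsD2)
  have "(\<Sum>j<order_of G. weight \<alpha> G z (vertex G j) * x (vertex G j))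
    = (\<Sum>w\<in>pverts G. weight \<alpha> G z w * x w)"
    by (rule sum.reindex_bij_betw[OF bij_betw_vertex[OF fin]])
  also have "\<dots> = (\<Sum>w\<in>pverts G. if w = z then \<alpha> * real (card (parcs G `` {z})) * x w else 0)
    + (\<Sum>w\<in>pverts G. if w \<in> parcs G `` {z} then (1 - \<alpha>) * x w else 0)"
    unfolding sum.distrib[symmetric]
    by (intro sum.cong) (auto simp: weight_def algebra_simps)
  also have "\<dots> = \<alpha> * real (card (parcs G `` {z})) * x z + (1 - \<alpha>) * (\<Sum>w\<in>parcs G `` {z}. x w)"
    using assms(2) fin sub
    by (simp add: sum.inter_restrict[symmetric] Int_absorb1 sum_distrib_left del: Image_singleton_iff)
  finally show ?thesis .
qed

locale strong_pair_digraph = pair_digraph G for G :: "nat pair_pre_digraph" +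
  fixes \<alpha> \<beta> :: real
  assumes alpha: "0 \<le> \<alpha>" "\<alpha> < 1" and beta: "\<beta> = \<alpha> / (1 - \<alpha>)"
    and strong: "strongly_connected (with_proj G)"
begin

abbreviation out :: "nat \<Rightarrow> nat set" where "out z \<equiv> parcs G `` {z}"

lemma verts_nonempty: "pverts G \<noteq> {}"
  using strong by (simp add: strongly_connected_def)

lemma finite_out: "finite (out z)"
  by (rule finite_subset[OF _ pair_finite_verts]) (auto dest: in_arcsD2)

lemma order_pos: "order_of G > 0"
  using verts_nonempty pair_finite_verts by (simp add: order_of_def card_gt_0_iff)

lemma weight_nonneg: "weight \<alpha> G z w \<ge> 0"
  using alpha by (auto simp: weight_def)

lemma vertex_in: "i < order_of G \<Longrightarrow> vertex G i \<in> pverts G"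
  using bij_betw_vertex[OF pair_finite_verts] by (auto simp: bij_betw_def)

text \<open>With \<open>\<beta> = \<alpha> / (1 - \<alpha>)\<close> and \<open>\<lambda> = \<alpha> + (1 - \<alpha>) s\<close> the eigenvalue equation of \<open>A\<^sub>\<alpha>\<close> at a
  vertex of outdegree \<open>d\<close> reads \<open>s x z = \<beta> (d - 1) x z + (\<Sum>w\<in>out z. x w)\<close>.\<close>

lemma scaled_equation:
  fixes X d S s :: real
  shows "\<alpha> * d * X + (1 - \<alpha>) * S - (\<alpha> + (1 - \<alpha>) * s) * X = (1 - \<alpha>) * (\<beta> * (d - 1) * X + S - s * X)"
proof -
  have ab: "(1 - \<alpha>) * \<beta> = \<alpha>" using alpha by (simp add: beta)
  have "(1 - \<alpha>) * (\<beta> * (d - 1) * X + S - s * X)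
    = ((1 - \<alpha>) * \<beta>) * (d - 1) * X + (1 - \<alpha>) * S - (1 - \<alpha>) * s * X"
    by (simp add: algebra_simps)
  then show ?thesis unfolding ab by (simp add: algebra_simps)
qed

lemma lambda_alpha_geI:
  fixes x :: "nat \<Rightarrow> real"
  assumes v: "v \<in> pverts G" "x v > 0"
    and le: "\<And>z. z \<in> pverts G \<Longrightarrow> s * x z \<le> \<beta> * (real (card (out z)) - 1) * x z + (\<Sum>w\<in>out z. x w)"
  shows "\<alpha> + (1 - \<alpha>) * s \<le> lambda_alpha \<alpha> G"
proof -
  obtain k where k: "k < order_of G" "vertex G k = v"
    using bij_betw_vertex[OF pair_finite_verts] v by (force simp: bij_betw_def)
  show ?thesis
    unfolding lambda_alpha_def
  proof (rule spectral_radius_geI[OF A_alpha_carrier A_alpha_index[OF pair_finite_verts],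
        where x = "\<lambda>i. x (vertex G i)"])
    fix i assume i: "i < order_of G"
    let ?z = "vertex G i"
    have "0 \<le> (1 - \<alpha>) * (\<beta> * (real (card (out ?z)) - 1) * x ?z + (\<Sum>w\<in>out ?z. x w) - s * x ?z)"
      using le[OF vertex_in[OF i]] alpha by simp
    then show "(\<alpha> + (1 - \<alpha>) * s) * x ?z
      \<le> (\<Sum>j<order_of G. weight \<alpha> G ?z (vertex G j) * x (vertex G j))"
      unfolding sum_weight[OF pair_digraph_axioms vertex_in[OF i]] scaled_equation[symmetric] by simp
  qed (use k v in \<open>auto simp: weight_nonneg\<close>)
qed

lemma lambda_alpha_leI:
  fixes x :: "nat \<Rightarrow> real"
  assumes pos: "\<And>z. z \<in> pverts G \<Longrightarrow> x z > 0"
    and le: "\<And>z. z \<in> pverts G \<Longrightarrow> \<beta> * (real (card (out z)) - 1) * x z + (\<Sum>w\<in>out z. x w) \<le> s * x z"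
  shows "lambda_alpha \<alpha> G \<le> \<alpha> + (1 - \<alpha>) * s"
  unfolding lambda_alpha_def
proof (rule spectral_radius_leI[OF A_alpha_carrier order_pos A_alpha_index[OF pair_finite_verts],
        where x = "\<lambda>i. x (vertex G i)"])
  fix i assume i: "i < order_of G"
  let ?z = "vertex G i"
  have "(1 - \<alpha>) * (\<beta> * (real (card (out ?z)) - 1) * x ?z + (\<Sum>w\<in>out ?z. x w) - s * x ?z) \<le> 0"
    using le[OF vertex_in[OF i]] alpha by (intro mult_nonneg_nonpos) auto
  then show "(\<Sum>j<order_of G. weight \<alpha> G ?z (vertex G j) * x (vertex G j)) \<le> (\<alpha> + (1 - \<alpha>) * s) * x ?z"
    unfolding sum_weight[OF pair_digraph_axioms vertex_in[OF i]] scaled_equation[symmetric] by simp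
qed (use pos in \<open>auto simp: weight_nonneg vertex_in\<close>)

text \<open>The constant vector 1 solves the scaled equation with \<open>s = 1\<close>.\<close>

lemma lambda_alpha_eq_1:
  assumes "\<And>z. z \<in> pverts G \<Longrightarrow> card (out z) = 1"
  shows "lambda_alpha \<alpha> G = 1"
proof -
  obtain v where "v \<in> pverts G" using verts_nonempty by auto
  then show ?thesis
    using lambda_alpha_leI[of "\<lambda>_. 1" 1] lambda_alpha_geI[of v "\<lambda>_. 1" 1] assms by fastforce
qed

text \<open>The vector \<open>(1 / s) ^ d z\<close> solves the scaled equation exactly: away from
  \<open>v\<close> the only arc lowers \<open>d\<close> by one, and at \<open>v\<close> the equation
  is the one assumed for \<open>s\<close>. An abstract \<open>d\<close> admits both distances and
  explicit formulas.\<close>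

lemma lambda_alpha_eqI:
  fixes d :: "nat \<Rightarrow> nat"
  assumes v: "v \<in> pverts G" and d0: "d v = 0"
    and out_v: "out v = {w1, w2}" "w1 \<noteq> w2"
    and step: "\<And>z. z \<in> pverts G \<Longrightarrow> z \<noteq> v \<Longrightarrow> \<exists>z'. out z = {z'} \<and> d z = Suc (d z')"
    and s: "s > 0" "s - \<beta> = (1 / s) ^ d w1 + (1 / s) ^ d w2"
  shows "lambda_alpha \<alpha> G = \<alpha> + (1 - \<alpha>) * s"
proof -
  let ?x = "\<lambda>z. (1 / s) ^ d z"
  have eq: "\<beta> * (real (card (out z)) - 1) * ?x z + (\<Sum>w\<in>out z. ?x w) = s * ?x z"
    if z: "z \<in> pverts G" for z
  proof (cases "z = v")
    case True
    then show ?thesis using out_v d0 s by simp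
  next
    case False
    then obtain z' where "out z = {z'}" "d z = Suc (d z')" using step z by blast
    then show ?thesis using s by simp
  qed
  show ?thesis
    using lambda_alpha_leI[of ?x s] lambda_alpha_geI[of v ?x s] eq s v
    by (simp add: antisym)
qed

end

section \<open>Distances in a strong digraph\<close>

context strong_pair_digraph begin

text \<open>The directed distance from \<open>z\<close> to \<open>v\<close>. The
  \<open>LEAST\<close> is informative only if a walk exists, which strong connectivity grants
  between vertices.\<close>

definition hops :: "nat \<Rightarrow> nat \<Rightarrow> nat" where
  "hops z v = (LEAST k. (z, v) \<in> parcs G ^^ k)"

lemma relpow_hops:
  assumes "z \<in> pverts G" "v \<in> pverts G"
  shows "(z, v) \<in> parcs G ^^ hops z v"
proof -
  have "reachable (with_proj G) z v" using strong assms by (auto simp: strongly_connected_def)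
  from reachable_rtranclI[OF this] have "(z, v) \<in> (parcs G)\<^sup>*" by simp
  then obtain k where "(z, v) \<in> parcs G ^^ k" by (auto simp: rtrancl_power)
  then show ?thesis unfolding hops_def by (rule LeastI)
qed

lemma hops_le: "(z, v) \<in> parcs G ^^ k \<Longrightarrow> hops z v \<le> k"
  unfolding hops_def by (rule Least_le)

lemma hops_self [simp]: "hops v v = 0"
  using hops_le[of v v 0] by simp

lemma hops_triangle:
  assumes "a \<in> pverts G" "b \<in> pverts G" "c \<in> pverts G"
  shows "hops a c \<le> hops a b + hops b c"
  using assms by (intro hops_le) (auto simp: relpow_add intro!: relpow_hops)

lemma hops_arc: "(a, b) \<in> parcs G \<Longrightarrow> hops a b \<le> 1"
  using hops_le[of a b 1] by simp

text \<open>\<open>w\<close> is the second vertex of a shortest walk; by the triangle inequality the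
  rest of that walk is again shortest.\<close>

lemma hops_step:
  assumes "z \<in> pverts G" "v \<in> pverts G" "z \<noteq> v"
  obtains w where "w \<in> out z" "w \<in> pverts G" "hops z v = Suc (hops w v)"
proof -
  have zv: "(z, v) \<in> parcs G ^^ hops z v" using assms relpow_hops by blast
  with assms(3) have "hops z v \<noteq> 0" by (metis pair_in_Id_conv relpow.simps(1))
  then obtain k where k: "hops z v = Suc k" by (cases "hops z v") auto
  with zv obtain w where w: "(z, w) \<in> parcs G" "(w, v) \<in> parcs G ^^ k"
    by (metis relpow_Suc_D2)
  have wV: "w \<in> pverts G" using w in_arcsD2 by blast
  have "hops w v \<le> k" using w hops_le by blast
  moreover have "hops z v \<le> Suc (hops w v)"
    using hops_triangle[OF assms(1) wV assms(2)] hops_arc[OF w(1)] by simp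
  ultimately show ?thesis using that w wV k by simp
qed

lemma hops_out_ge:
  assumes "w \<in> out z" "v \<in> pverts G"
  shows "hops z v \<le> Suc (hops w v)"
  using hops_triangle[of z w v] hops_arc[of z w] assms in_arcsD1 in_arcsD2
  by (metis Image_singleton_iff add_le_mono1 order.trans plus_1_eq_Suc)

text \<open>\<open>c\<close> is reached after \<open>j\<close> steps of a shortest walk. The bound
  on \<open>hops z c\<close> is kept because, once \<open>c\<close> is identified by its level, it
  bounds the distance from an out-neighbour back to a branching vertex.\<close>

lemma hops_descend:
  assumes "z \<in> pverts G" "v \<in> pverts G" "j \<le> hops z v"
  shows "\<exists>c \<in> pverts G. hops c v + j = hops z v \<and> hops z c \<le> j"
  using assms(3)
proof (induction j)
  case 0
  then show ?case using assms by auto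
next
  case (Suc j)
  then obtain c where c: "c \<in> pverts G" "hops c v + j = hops z v" "hops z c \<le> j" by auto
  with Suc.prems have "c \<noteq> v" by auto
  then obtain w where w: "w \<in> out c" "w \<in> pverts G" "hops c v = Suc (hops w v)"
    using hops_step c(1) assms(2) by blast
  have "hops z w \<le> hops z c + hops c w" using hops_triangle assms c w by blast
  also have "\<dots> \<le> Suc j" using c(3) hops_arc[of c w] w(1) by auto
  finally show ?case using w c by auto
qed

lemma hops_levels:
  assumes "z \<in> pverts G" "v \<in> pverts G"
  shows "{..hops z v} \<subseteq> (\<lambda>c. hops c v) ` pverts G"
proof
  fix k assume "k \<in> {..hops z v}"
  then obtain c where "c \<in> pverts G" "hops c v + (hops z v - k) = hops z v"
    using hops_descend[OF assms, of "hops z v - k"] by auto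
  with \<open>k \<in> {..hops z v}\<close> have "k = hops c v" by simp
  with \<open>c \<in> pverts G\<close> show "k \<in> (\<lambda>c. hops c v) ` pverts G" by blast
qed

lemma hops_less:
  assumes "z \<in> pverts G" "v \<in> pverts G"
  shows "hops z v < order_of G"
proof -
  have "card {..hops z v} \<le> card ((\<lambda>c. hops c v) ` pverts G)"
    using hops_levels[OF assms] pair_finite_verts by (intro card_mono) auto
  also have "\<dots> \<le> order_of G"
    unfolding order_of_def using pair_finite_verts by (rule card_image_le)
  finally show ?thesis by simp
qed

text \<open>A shortest walk of this length meets \<open>order_of G\<close> distinct levels, so there
  are as many levels as vertices.\<close>

lemma hops_inj_on:
  assumes "z \<in> pverts G" "v \<in> pverts G" "Suc (hops z v) = order_of G"
  shows "inj_on (\<lambda>c. hops c v) (pverts G)"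
proof (rule eq_card_imp_inj_on[OF pair_finite_verts])
  have "card {..hops z v} \<le> card ((\<lambda>c. hops c v) ` pverts G)"
    using hops_levels[OF assms(1,2)] pair_finite_verts by (intro card_mono) auto
  then show "card ((\<lambda>c. hops c v) ` pverts G) = card (pverts G)"
    using assms(3) card_image_le[OF pair_finite_verts, of "\<lambda>c. hops c v"]
    by (simp add: order_of_def)
qed

text \<open>Dropping \<open>w1\<close> loses no level, because \<open>w2\<close> stays on the same
  one. The \<open>order_of G - 1\<close> remaining vertices cover the levels from 0 to
  \<open>order_of G - 2\<close>.\<close>

lemma hops_inj_on_Diff:
  assumes w: "w1 \<in> pverts G" "w2 \<in> pverts G" "w1 \<noteq> w2" and v: "v \<in> pverts G"
    and "hops w1 v = hops w2 v" "Suc (Suc (hops w1 v)) = order_of G"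
  shows "inj_on (\<lambda>c. hops c v) (pverts G - {w1})"
proof (rule eq_card_imp_inj_on)
  let ?d = "\<lambda>c. hops c v"
  have "?d ` pverts G = ?d ` (pverts G - {w1})" using w assms(5) by (auto simp: image_iff)
  then have "card {..hops w1 v} \<le> card (?d ` (pverts G - {w1}))"
    using hops_levels[OF w(1) v] pair_finite_verts by (intro card_mono) auto
  then show "card (?d ` (pverts G - {w1})) = card (pverts G - {w1})"
    using assms(6) w(1) card_image_le[of "pverts G - {w1}" ?d] pair_finite_verts
    by (simp add: order_of_def)
qed (simp add: pair_finite_verts)

text \<open>A vertex beyond the twins would have distance \<open>order_of G - 1\<close>, which
  allows one vertex per level only.\<close>

lemma hops_le_of_twins:
  assumes w: "w1 \<in> pverts G" "w2 \<in> pverts G" "w1 \<noteq> w2" and v: "v \<in> pverts G"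
    and "hops w1 v = hops w2 v" "Suc (Suc (hops w1 v)) = order_of G" and z: "z \<in> pverts G"
  shows "hops z v \<le> hops w1 v"
proof (rule ccontr)
  assume "\<not> hops z v \<le> hops w1 v"
  then have "Suc (hops z v) = order_of G" using hops_less[OF z v] assms(6) by simp
  from hops_inj_on[OF z v this] show False using w assms(5) by (auto simp: inj_on_def)
qed

section \<open>Lower bound on the radius from one branching vertex\<close>

lemma beta_nonneg: "\<beta> \<ge> 0"
  using alpha by (simp add: beta)

text \<open>At \<open>z \<noteq> v\<close> the next vertex of a shortest walk alone contributes
  \<open>s\<close> times the value at \<open>z\<close>, and further arcs only add nonnegative terms.
  At \<open>v\<close> the two out-neighbours and the degree term, which is at least
  \<open>\<beta>\<close>, suffice by the assumption on \<open>s\<close>.\<close>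

lemma lambda_alpha_ge_two_cycles:
  assumes v: "v \<in> pverts G" and w: "w1 \<in> out v" "w2 \<in> out v" "w1 \<noteq> w2"
    and s: "s > 0" "s - \<beta> \<le> (1 / s) ^ hops w1 v + (1 / s) ^ hops w2 v"
  shows "\<alpha> + (1 - \<alpha>) * s \<le> lambda_alpha \<alpha> G"
proof (rule lambda_alpha_geI[OF v, where x = "\<lambda>z. (1 / s) ^ hops z v"])
  let ?x = "\<lambda>z. (1 / s) ^ hops z v"
  fix z assume z: "z \<in> pverts G"
  show "s * ?x z \<le> \<beta> * (real (card (out z)) - 1) * ?x z + (\<Sum>w\<in>out z. ?x w)"
  proof (cases "z = v")
    case True
    have "card {w1, w2} \<le> card (out v)" using w finite_out by (intro card_mono) auto
    then have "\<beta> * 1 \<le> \<beta> * (real (card (out v)) - 1)"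
      using w beta_nonneg by (intro mult_left_mono) auto
    moreover have "(\<Sum>w\<in>{w1, w2}. ?x w) \<le> (\<Sum>w\<in>out v. ?x w)"
      using w s finite_out by (intro sum_mono2) auto
    ultimately show ?thesis using True w s by simp
  next
    case False
    then obtain w where w: "w \<in> out z" "hops z v = Suc (hops w v)"
      using hops_step z v by blast
    have "?x w \<le> (\<Sum>w\<in>out z. ?x w)"
      using s w finite_out by (intro member_le_sum) auto
    moreover have "card (out z) > 0" using w finite_out by (auto simp: card_gt_0_iff)
    then have "0 \<le> \<beta> * (real (card (out z)) - 1) * ?x z"
      using beta_nonneg s by (intro mult_nonneg_nonneg) auto
    ultimately show ?thesis using w s by simp
  qed
qed simp

end

section \<open>Digraphs of small spectral radius\<close>

text \<open>Here \<open>s\<close> is the parameter of \<open>\<theta>(0,2,n-4)\<close>, whose two cycles have lengths \<open>n - 2\<close> and \<open>n\<close>.\<close>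

locale small_radius_digraph = strong_pair_digraph +
  fixes n :: nat and s :: real
  assumes order: "order_of G = n" and n5: "n \<ge> 5"
    and s: "1 < s" "s \<le> 2" "s - \<beta> = (1 / s) ^ (n - 3) + (1 / s) ^ (n - 1)"
    and small: "lambda_alpha \<alpha> G < \<alpha> + (1 - \<alpha>) * s"
begin

lemma hops_less_n: "z \<in> pverts G \<Longrightarrow> v \<in> pverts G \<Longrightarrow> hops z v < n"
  using hops_less order by simp

lemma out_verts: "w \<in> out v \<Longrightarrow> v \<in> pverts G" "w \<in> out v \<Longrightarrow> w \<in> pverts G"
  by (auto dest: in_arcsD1 in_arcsD2)

lemma no_loop: "z \<notin> out z"
  using pair_no_loops by fastforce

text \<open>A distance of at most \<open>n - 3\<close>, together with the general bound
  \<open>n - 1\<close> on the other one, would make the two powers at least those in the equation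
  for \<open>s\<close>, contradicting \<open>small\<close>.\<close>

lemma hops_out_far:
  assumes w: "w1 \<in> out v" "w2 \<in> out v" "w1 \<noteq> w2"
  shows "n - 2 \<le> hops w1 v"
proof (rule ccontr)
  assume "\<not> n - 2 \<le> hops w1 v"
  then have "(1 / s) ^ (n - 3) \<le> (1 / s) ^ hops w1 v"
    using s by (intro power_decreasing) auto
  moreover have "(1 / s) ^ (n - 1) \<le> (1 / s) ^ hops w2 v"
    using s hops_less_n[of w2 v] w out_verts by (intro power_decreasing) auto
  ultimately have "s - \<beta> \<le> (1 / s) ^ hops w1 v + (1 / s) ^ hops w2 v"
    using s(3) by linarith
  from lambda_alpha_ge_two_cycles[OF out_verts(1)[OF w(1)] w _ this] show False
    using s(1) small by simp
qed

text \<open>On the Hamiltonian cycle \<open>z \<rightarrow> v \<rightarrow> w1 \<rightarrow> w2 \<rightarrow> \<dots> \<rightarrow> z\<close> the arcs \<open>z \<rightarrow> w1\<close> and \<open>v \<rightarrow> w2\<close> each skip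
  one vertex.  The value of the test vector at \<open>v\<close> is the one that makes the eigenvalue equation
  hold there; the inequality at \<open>z\<close> then needs \<open>s \<le> 2\<close>, which is where \<open>\<alpha> \<le> 1/2\<close> enters.\<close>

lemma no_consecutive_shortcuts:
  assumes v: "v \<in> pverts G" and w: "w1 \<in> out v" "w2 \<in> out v" "w1 \<noteq> w2"
    and hw: "hops w1 v = n - 1" "hops w2 v = n - 2"
    and z: "z \<in> pverts G" "hops z v = 1" "w1 \<in> out z" "v \<in> out z"
  shows False
proof -
  define t where "t = 1 / s"
  have t: "0 < t" "t < 1" "1 / 2 \<le> t" "s * t = 1" using s by (auto simp: t_def field_simps)
  define E where "E = s - \<beta>"
  have E: "E = t ^ (n - 3) + t ^ (n - 1)" using s by (simp add: E_def t_def)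
  have E0: "E > 0" using t by (simp add: E add_pos_pos)
  define x where "x c = (if c = v then (t ^ (n - 2) + t ^ (n - 1)) / E else t ^ hops c v)" for c
  have xpos: "x c > 0" for c using t E0 by (simp add: x_def add_pos_pos)
  have wv: "w1 \<noteq> v" "w2 \<noteq> v" using w no_loop by auto
  have zv: "z \<noteq> v" using z by auto
  have card2: "\<beta> \<le> \<beta> * (real (card (out c)) - 1)" if "a \<in> out c" "b \<in> out c" "a \<noteq> b" for a b c
  proof -
    have "card {a, b} \<le> card (out c)" using that finite_out by (intro card_mono) auto
    then have "\<beta> * 1 \<le> \<beta> * (real (card (out c)) - 1)"
      using that beta_nonneg by (intro mult_left_mono) auto
    then show ?thesis by simp
  qed
  \<comment> \<open>Two out-neighbours make the degree term at least \<open>\<beta> * x c\<close>;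
    moving \<open>\<beta>\<close> to the left leaves the factor
    \<open>E = s - \<beta>\<close>.\<close>
  have two: "E * x c \<le> x a + x b \<Longrightarrow> s * x c \<le> \<beta> * (real (card (out c)) - 1) * x c + (\<Sum>w\<in>out c. x w)"
    if ab: "a \<in> out c" "b \<in> out c" "a \<noteq> b" for a b c
  proof -
    assume "E * x c \<le> x a + x b"
    moreover have "(\<Sum>w\<in>{a, b}. x w) \<le> (\<Sum>w\<in>out c. x w)"
      using ab xpos finite_out by (intro sum_mono2) (auto intro: less_imp_le)
    moreover have "\<beta> * x c \<le> \<beta> * (real (card (out c)) - 1) * x c"
      using card2[OF ab] xpos[of c] by (intro mult_right_mono) auto
    ultimately show ?thesis using ab by (simp add: E_def algebra_simps)
  qed
  have "\<alpha> + (1 - \<alpha>) * s \<le> lambda_alpha \<alpha> G"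
  proof (rule lambda_alpha_geI[OF v xpos])
    fix c assume c: "c \<in> pverts G"
    consider "c = v" | "c = z" | "c \<noteq> v" "c \<noteq> z" by blast
    then show "s * x c \<le> \<beta> * (real (card (out c)) - 1) * x c + (\<Sum>w\<in>out c. x w)"
    proof cases
      case 1
      have "E * x v \<le> x w1 + x w2" using wv hw E0 by (simp add: x_def)
      then show ?thesis using two[OF w] 1 by simp
    next
      case 2
      \<comment> \<open>Here \<open>x z = t\<close>. Expanding \<open>E\<close> in
        \<open>E * t\<close> gives powers of \<open>t\<close>; \<open>1 / 2 \<le> t\<close> trades
        \<open>t ^ (n - 2)\<close> for twice \<open>t ^ (n - 1)\<close>, and
        \<open>E \<le> s\<close> in the form \<open>E * t \<le> 1\<close> brings in the value at
        \<open>v\<close>.\<close>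
      have "n - 1 = Suc (n - 2)" "n - 2 = Suc (n - 3)" using n5 by auto
      then have tn: "t ^ (n - 1) = t * t ^ (n - 2)" "t ^ (n - 2) = t * t ^ (n - 3)"
        by (metis power_Suc)+
      have "E * t \<le> 1"
        using t beta_nonneg mult_right_mono[of E s t] by (simp add: E_def)
      have key: "t ^ (n - 2) \<le> 2 * t ^ (n - 1)"
        using t mult_right_mono[of 1 "2 * t" "t ^ (n - 2)"] unfolding tn(1) by simp
      have "E * t - t ^ (n - 1) \<le> t ^ (n - 2) + t * t ^ (n - 1) - t ^ (n - 1)"
        unfolding E tn(2) by (simp add: algebra_simps)
      also have "\<dots> \<le> t ^ (n - 1) + t * t ^ (n - 1)" using key by simp
      also have "\<dots> = t * (t ^ (n - 2) + t ^ (n - 1))"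
        by (simp only: tn(1)) (simp add: algebra_simps)
      also have "\<dots> \<le> (1 / E) * (t ^ (n - 2) + t ^ (n - 1))"
        using \<open>E * t \<le> 1\<close> E0 t by (intro mult_right_mono) (auto simp: field_simps)
      finally have "E * x z \<le> x w1 + x v"
        using zv wv z hw by (simp add: x_def)
      then show ?thesis using two[OF z(3,4) wv(1)] 2 by simp
    next
      case 3
      obtain b where b: "b \<in> out c" "b \<in> pverts G" "hops c v = Suc (hops b v)"
        using hops_step[OF c v] 3 by blast
      \<comment> \<open>Only \<open>z\<close> lies on level 1, so \<open>b\<close> is not
        \<open>v\<close> and both values are plain powers of \<open>t\<close>.\<close>
      have "inj_on (\<lambda>c. hops c v) (pverts G)"
        using hops_inj_on[of w1 v] out_verts w(1) v hw order n5 by simp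
      then have "hops c v \<noteq> 1" using z c 3 by (auto simp: inj_on_def)
      then have "b \<noteq> v" using b by auto
      then have "s * x c = x b" using 3 b t by (simp add: x_def mult.assoc[symmetric])
      also have "\<dots> \<le> (\<Sum>w\<in>out c. x w)"
        using xpos b finite_out by (intro member_le_sum) (auto intro: less_imp_le)
      moreover have "card (out c) > 0" using b finite_out by (auto simp: card_gt_0_iff)
      then have "0 \<le> \<beta> * (real (card (out c)) - 1) * x c"
        using beta_nonneg xpos[of c] by (intro mult_nonneg_nonneg) auto
      ultimately show ?thesis by simp
    qed
  qed
  then show False using small by simp
qed

text \<open>Each level holds one vertex, and out-neighbours of \<open>v\<close> can only lie on the
  top two. A second arc at another vertex \<open>z\<close> must ascend, and descending from its head
  leads back to \<open>z\<close>; \<open>hops_out_far\<close> leaves only the configuration of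
  \<open>no_consecutive_shortcuts\<close>.\<close>

lemma hamiltonian_case:
  assumes w: "w1 \<in> out v" "w2 \<in> out v"
    and hw: "hops w1 v = n - 1" "hops w2 v = n - 2"
  shows "out v = {w1, w2}"
    and "\<And>z. z \<in> pverts G \<Longrightarrow> z \<noteq> v \<Longrightarrow> \<exists>z'. out z = {z'} \<and> hops z v = Suc (hops z' v)"
proof -
  have v: "v \<in> pverts G" using w out_verts by blast
  have ne: "w1 \<noteq> w2" using hw n5 by auto
  have inj: "a = b" if "a \<in> pverts G" "b \<in> pverts G" "hops a v = hops b v" for a b
    using hops_inj_on[of w1 v] out_verts w(1) v hw order n5 that by (simp add: inj_on_def)
  have "u = w2" if u: "u \<in> out v" "u \<noteq> w1" for u
  proof -
    have uV: "u \<in> pverts G" using u out_verts by blast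
    have "hops u v \<noteq> n - 1" using inj[of u w1] u w hw out_verts by metis
    then have "hops u v = n - 2"
      using hops_out_far[OF u(1) w(1) u(2)] hops_less_n[OF uV v] by simp
    then show ?thesis using inj[of u w2] uV w hw out_verts by metis
  qed
  then show "out v = {w1, w2}" using w by blast
  fix z assume z: "z \<in> pverts G" "z \<noteq> v"
  obtain b where b: "b \<in> out z" "b \<in> pverts G" "hops z v = Suc (hops b v)"
    using hops_step[OF z(1) v z(2)] by blast
  have "a = b" if a: "a \<in> out z" for a
  proof (rule ccontr)
    assume ab: "a \<noteq> b"
    have aV: "a \<in> pverts G" using a out_verts by blast
    have "hops z v \<le> Suc (hops a v)" using hops_out_ge[OF a v] .
    moreover have "hops a v \<noteq> hops z v" using inj[OF aV z(1)] a no_loop by blast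
    moreover have "hops a v \<noteq> hops b v" using inj[OF aV b(2)] ab by blast
    \<comment> \<open>An arc descends by at most one level, and the levels of \<open>z\<close> and
      \<open>b\<close> contain no other vertex.\<close>
    ultimately have less: "hops z v < hops a v" using b by simp
    obtain c where c: "c \<in> pverts G" "hops c v + (hops a v - hops z v) = hops a v"
      "hops a c \<le> hops a v - hops z v"
      using hops_descend[OF aV v, of "hops a v - hops z v"] by auto
    have "c = z" using c less by (intro inj[OF c(1) z(1)]) simp
    then have "n - 2 \<le> hops a v - hops z v"
      using c hops_out_far[OF a b(1) ab] by simp
    moreover have "hops a v < n" using hops_less_n[OF aV v] .
    \<comment> \<open>The levels range from 1 for \<open>z\<close> to \<open>n - 1\<close> for
      \<open>a\<close>, so a difference of at least \<open>n - 2\<close> forces both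
      extremes.\<close>
    ultimately have hz: "hops z v = 1" "hops a v = n - 1" using b(3) less n5 by linarith+
    have "a = w1" using inj[OF aV _ ] hz hw w out_verts by metis
    moreover have "b = v" using inj[OF b(2) v] b hz by simp
    ultimately show False
      using no_consecutive_shortcuts[OF v w ne hw z(1) hz(1)] a b by blast
  qed
  then have "out z = {b}" using b by blast
  with b show "\<exists>z'. out z = {z'} \<and> hops z v = Suc (hops z' v)" by blast
qed

text \<open>Levels below \<open>n - 2\<close> hold one vertex each, and the top level holds just the
  twins. A second arc at \<open>z \<noteq> v\<close> can only join the twins, and then the
  out-neighbours of \<open>z\<close> have distances \<open>n - 1\<close> and \<open>n - 2\<close> to
  \<open>z\<close>. This is why \<open>no_ham\<close> speaks of every vertex, not only of
  \<open>v\<close>.\<close>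

lemma twin_case:
  assumes w: "w1 \<in> out v" "w2 \<in> out v" "w1 \<noteq> w2"
    and hw: "hops w1 v = n - 2" "hops w2 v = n - 2"
    and no_ham: "\<And>a b c. b \<in> out a \<Longrightarrow> c \<in> out a \<Longrightarrow> hops b a = n - 1 \<Longrightarrow> hops c a \<noteq> n - 2"
  shows "out v = {w1, w2}"
    and "\<And>z. z \<in> pverts G \<Longrightarrow> z \<noteq> v \<Longrightarrow> \<exists>z'. out z = {z'} \<and> hops z v = Suc (hops z' v)"
proof -
  have v: "v \<in> pverts G" and wV: "w1 \<in> pverts G" "w2 \<in> pverts G" using w out_verts by blast+
  have le: "hops c v \<le> n - 2" if "c \<in> pverts G" for c
    using hops_le_of_twins[OF wV w(3) v] hw order n5 that by simp
  have "inj_on (\<lambda>c. hops c v) (pverts G - {w1})"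
    using hw order n5 by (intro hops_inj_on_Diff[OF wV w(3) v]) auto
  from inj_onD[OF this] have inj: "a = b"
    if "a \<in> pverts G" "b \<in> pverts G" "hops a v = hops b v" "a \<noteq> w1" "b \<noteq> w1" for a b
    using that by blast
  have top: "a = w1 \<or> a = w2" if "a \<in> pverts G" "hops a v = n - 2" for a
    using inj[OF that(1) wV(2)] that hw w(3) by auto
  have low: "a = b" if "a \<in> pverts G" "b \<in> pverts G" "hops a v = hops b v" "hops b v < n - 2" for a b
  proof -
    have "b \<noteq> w1" "a \<noteq> w1" using that(3,4) hw(1) by auto
    then show ?thesis using inj that by blast
  qed
  have "u \<in> {w1, w2}" if u: "u \<in> out v" for u
    using top[of u] hops_out_far[OF u w(1)] le[of u] u out_verts by force
  then show "out v = {w1, w2}" using w by blast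
  fix z assume z: "z \<in> pverts G" "z \<noteq> v"
  obtain b where b: "b \<in> out z" "b \<in> pverts G" "hops z v = Suc (hops b v)"
    using hops_step[OF z(1) v z(2)] by blast
  have "a = b" if a: "a \<in> out z" for a
  proof (rule ccontr)
    assume ab: "a \<noteq> b"
    have aV: "a \<in> pverts G" using a out_verts by blast
    have far: "n - 2 \<le> hops a z" "n - 2 \<le> hops b z"
      using hops_out_far[OF a b(1) ab] hops_out_far[OF b(1) a] ab by auto
    have "hops z v \<le> Suc (hops a v)" using hops_out_ge[OF a v] .
    moreover have "hops a v \<noteq> hops b v"
      using low[OF aV b(2)] ab b(3) le[OF z(1)] by auto
    ultimately have ge: "hops z v \<le> hops a v" using b(3) by simp
    \<comment> \<open>After an ascending arc, a shortest walk from \<open>a\<close> to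
      \<open>v\<close> would pass \<open>z\<close> within \<open>n - 3\<close> steps, contradicting
      \<open>far\<close>.\<close>
    have "\<not> hops z v < hops a v"
    proof
      assume less: "hops z v < hops a v"
      obtain c where c: "c \<in> pverts G" "hops c v + (hops a v - hops z v) = hops a v"
        "hops a c \<le> hops a v - hops z v"
        using hops_descend[OF aV v, of "hops a v - hops z v"] by auto
      have "c = z" using c less le[OF aV] by (intro low[OF c(1) z(1)]) auto
      then show False using c far(1) le[OF aV] b(3) n5 by auto
    qed
    with ge have eq: "hops a v = hops z v" by simp
    have az: "a \<noteq> z" using a no_loop by blast
    have "hops z v = n - 2" using low[OF aV z(1) eq] az le[OF z(1)] by force
    then have zw: "z = w1 \<or> z = w2" "a = w1 \<or> a = w2" and hb: "hops b v = n - 3"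
      using top[OF z(1)] top[OF aV] eq b(3) n5 by auto
    \<comment> \<open>From \<open>b\<close> one reaches \<open>z\<close> through \<open>v\<close>,
      since the twin \<open>z\<close> is an out-neighbour of \<open>v\<close>.\<close>
    have "hops b z \<le> hops b v + hops v z" using hops_triangle[OF b(2) v z(1)] .
    moreover have "hops v z \<le> 1" using zw w by (intro hops_arc) auto
    ultimately have hbz: "hops b z = n - 2" using far(2) hb n5 by simp
    \<comment> \<open>The first step from \<open>a\<close> towards \<open>z\<close> leaves the top
      level, which contains only \<open>a\<close> and \<open>z\<close>; hence it goes to
      \<open>b\<close>.\<close>
    obtain c where c: "c \<in> out a" "c \<in> pverts G" "hops a z = Suc (hops c z)"
      using hops_step[OF aV z(1) az] by blast
    have "c \<noteq> z" using c far(1) n5 by auto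
    moreover have "c \<noteq> a" using c no_loop by blast
    ultimately have "hops c v \<noteq> n - 2" using top[OF c(2)] zw az by auto
    moreover have "hops a v \<le> Suc (hops c v)" using hops_out_ge[OF c(1) v] .
    ultimately have "hops c v = n - 3"
      using eq \<open>hops z v = n - 2\<close> le[OF c(2)] by simp
    then have "c = b" using low[OF c(2) b(2)] hb n5 by simp
    then have "hops a z = n - 1" using c hbz n5 by simp
    then show False using no_ham[OF a b(1)] hbz by simp
  qed
  then have "out z = {b}" using b by blast
  with b show "\<exists>z'. out z = {z'} \<and> hops z v = Suc (hops z' v)" by blast
qed

lemma lambda_alpha_cases:
  assumes w: "w1 \<in> out v" "w2 \<in> out v" "w1 \<noteq> w2"
    and s2: "s2 > 0" "s2 - \<beta> = (1 / s2) ^ (n - 2) + (1 / s2) ^ (n - 1)"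
    and s3: "s3 > 0" "s3 - \<beta> = (1 / s3) ^ (n - 2) + (1 / s3) ^ (n - 2)"
  shows "lambda_alpha \<alpha> G = \<alpha> + (1 - \<alpha>) * s2 \<or> lambda_alpha \<alpha> G = \<alpha> + (1 - \<alpha>) * s3"
\<comment> \<open>The split ranges over all vertices rather than \<open>v\<close>, because its
  negation supplies \<open>no_ham\<close> for \<open>twin_case\<close>.\<close>
proof (cases "\<exists>a b c. b \<in> out a \<and> c \<in> out a \<and> hops b a = n - 1 \<and> hops c a = n - 2")
  case True
  then obtain a b c where abc: "b \<in> out a" "c \<in> out a" "hops b a = n - 1" "hops c a = n - 2"
    by blast
  have "b \<noteq> c" using abc n5 by auto
  then have "lambda_alpha \<alpha> G = \<alpha> + (1 - \<alpha>) * s2"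
    using abc s2 hamiltonian_case[OF abc] out_verts(1)[OF abc(1)]
    by (intro lambda_alpha_eqI[where v = a and d = "\<lambda>z. hops z a" and ?w1.0 = b and ?w2.0 = c]) auto
  then show ?thesis ..
next
  case False
  have v: "v \<in> pverts G" and wV: "w1 \<in> pverts G" "w2 \<in> pverts G" using w out_verts by blast+
  \<comment> \<open>With \<open>u\<close> on level \<open>n - 1\<close>, injectivity would push
    \<open>u'\<close> to level \<open>n - 2\<close>, the pair just excluded.\<close>
  have not_top: "hops u v \<noteq> n - 1" if u: "u \<in> out v" "u' \<in> out v" "u \<noteq> u'" for u u'
  proof
    assume h: "hops u v = n - 1"
    have uV: "u \<in> pverts G" "u' \<in> pverts G" using u out_verts by blast+
    have "inj_on (\<lambda>c. hops c v) (pverts G)"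
      using hops_inj_on[OF uV(1) v] h order n5 by simp
    then have "hops u' v \<noteq> n - 1" using h u uV by (metis inj_onD)
    then have "hops u' v = n - 2"
      using hops_out_far[OF u(2,1)] u(3) hops_less_n[OF uV(2) v] by auto
    then show False using False u h by blast
  qed
  have hw: "hops w1 v = n - 2" "hops w2 v = n - 2"
    using hops_out_far[OF w] hops_out_far[OF w(2,1)] not_top[OF w] not_top[OF w(2,1)] w(3)
      hops_less_n[OF wV(1) v] hops_less_n[OF wV(2) v] by auto
  have "lambda_alpha \<alpha> G = \<alpha> + (1 - \<alpha>) * s3"
  proof (rule lambda_alpha_eqI[where v = v and d = "\<lambda>z. hops z v"])
    show "out v = {w1, w2}" using twin_case(1)[OF w hw] False by blast
    show "\<exists>z'. out z = {z'} \<and> hops z v = Suc (hops z' v)" if "z \<in> pverts G" "z \<noteq> v" for z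
      using twin_case(2)[OF w hw] False that by blast
  qed (use v w s3 hw in auto)
  then show ?thesis ..
qed

end

section \<open>The extremal digraphs\<close>

context strong_pair_digraph begin

lemma out_nonempty:
  assumes "z \<in> pverts G" "order_of G \<ge> 2"
  shows "out z \<noteq> {}"
proof -
  have "\<not> pverts G \<subseteq> {z}"
    using assms(2) card_mono[of "{z}" "pverts G"] by (auto simp: order_of_def)
  then obtain v where "v \<in> pverts G" "z \<noteq> v" by blast
  then show ?thesis using hops_step[OF assms(1)] by blast
qed

text \<open>A walk from \<open>v\<close> is determined by its length, so the distance from
  \<open>v\<close>, opposite in direction to the levels used before, numbers the vertices
  injectively and serves as the isomorphism.\<close>

lemma digraph_iso_dicycle:
  assumes single: "\<And>z. z \<in> pverts G \<Longrightarrow> card (out z) = 1"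
  shows "digraph_iso (with_proj G) (with_proj (dicycle (order_of G)))"
proof -
  let ?n = "order_of G"
  obtain v where v: "v \<in> pverts G" using verts_nonempty by blast
  have uniq: "a = b" if "(z, a) \<in> parcs G" "(z, b) \<in> parcs G" for z a b
  proof -
    have "card (out z) = 1" using single in_arcsD1 that by blast
    then obtain y where "out z = {y}" by (auto simp: card_1_singleton_iff)
    then show ?thesis using that by (metis Image_singleton_iff singletonD)
  qed
  have fun_pow: "a = b" if "(v, a) \<in> parcs G ^^ k" "(v, b) \<in> parcs G ^^ k" for a b k
    using that by (induction k arbitrary: a b) (auto, metis uniq)
  have inj: "inj_on (hops v) (pverts G)"
    by (rule inj_onI) (metis fun_pow relpow_hops v)
  have img: "hops v ` pverts G = {..<?n}"
    using hops_less[OF v] card_image[OF inj]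
    by (intro card_subset_eq) (auto simp: order_of_def)
  have inner: "hops v b = Suc (hops v a)" if ab: "(a, b) \<in> parcs G" "Suc (hops v a) < ?n" for a b
  proof -
    obtain y where y: "y \<in> pverts G" "hops v y = Suc (hops v a)"
      using img ab(2) by (metis (no_types, lifting) imageE lessThan_iff)
    have "(v, b) \<in> parcs G ^^ Suc (hops v a)"
      using relpow_hops[OF v in_arcsD1[OF ab(1)]] ab(1) by auto
    then show ?thesis using fun_pow relpow_hops[OF v y(1)] y by metis
  qed
  \<comment> \<open>No walk from \<open>b\<close> reaches a number below that of \<open>b\<close>:
    each step raises the number by one or leaves the last vertex \<open>a\<close>, and then returns
    to \<open>b\<close>. Since \<open>v\<close> is reachable from \<open>b\<close>, the number of
    \<open>b\<close> is 0.\<close>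
  have wrap: "hops v b = 0" if ab: "(a, b) \<in> parcs G" "Suc (hops v a) = ?n" for a b
  proof -
    have aV: "a \<in> pverts G" and bV: "b \<in> pverts G" using ab in_arcsD1 in_arcsD2 by auto
    have "hops v b \<le> hops v c" if "(b, c) \<in> parcs G ^^ k" for c k
      using that
    proof (induction k arbitrary: c)
      case (Suc k)
      then obtain y where y: "hops v b \<le> hops v y" "(y, c) \<in> parcs G" by auto
      have yV: "y \<in> pverts G" using y in_arcsD1 by blast
      show ?case
      proof (cases "Suc (hops v y) < ?n")
        case True
        then show ?thesis using inner y by fastforce
      next
        case False
        then have "hops v y = hops v a" using ab(2) hops_less[OF v yV] by simp
        then have "y = a" using inj yV aV by (auto simp: inj_on_def)
        then show ?thesis using uniq y ab by blast
      qed
    qed simp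
    then show ?thesis using relpow_hops[OF bV v] by fastforce
  qed
  have arc: "hops v b = Suc (hops v a) mod ?n" if "(a, b) \<in> parcs G" for a b
    using inner[OF that] wrap[OF that] hops_less[OF v in_arcsD1[OF that]]
    by (cases "Suc (hops v a) = ?n") auto
  let ?h = "\<lparr>iso_verts = hops v, iso_arcs = map_prod (hops v) (hops v), iso_head = snd, iso_tail = fst\<rparr>"
  have "parcs G \<subseteq> pverts G \<times> pverts G" by (auto dest: in_arcsD1 in_arcsD2)
  then have "inj_on (map_prod (hops v) (hops v)) (parcs G)"
    using map_prod_inj_on[OF inj inj] inj_on_subset by blast
  then have "digraph_isomorphism ?h"
    using inj wf_digraph_axioms by (auto simp: digraph_isomorphism_def)
  moreover have "map_prod (hops v) (hops v) ` parcs G = {(i, Suc i mod ?n) |i. i < ?n}"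
  proof (intro equalityI subsetI)
    fix p assume "p \<in> map_prod (hops v) (hops v) ` parcs G"
    then show "p \<in> {(i, Suc i mod ?n) |i. i < ?n}"
      using arc hops_less[OF v] in_arcsD1 by auto
  next
    fix p assume "p \<in> {(i, Suc i mod ?n) |i. i < ?n}"
    then obtain i where i: "i < ?n" "p = (i, Suc i mod ?n)" by blast
    then obtain a where "a \<in> pverts G" "hops v a = i"
      using img by (metis imageE lessThan_iff)
    with i have a: "a \<in> pverts G" "p = (hops v a, Suc (hops v a) mod ?n)" by auto
    then obtain b where "(a, b) \<in> parcs G"
      using single[OF a(1)] by (auto simp: card_1_singleton_iff)
    then show "p \<in> map_prod (hops v) (hops v) ` parcs G" using a arc by (force simp: image_iff)
  qed
  then have "with_proj (dicycle ?n) = app_iso ?h (with_proj G)"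
    using img by (auto simp: app_iso_def with_proj_def dicycle_def lessThan_atLeast0)
  ultimately show ?thesis unfolding digraph_iso_def by blast
qed

end

section \<open>Roots of the equation with two cycle lengths\<close>

text \<open>Intermediate value theorem on the interval from 1 to 2. The bound
  \<open>\<beta> \<le> 1\<close>, equivalent to \<open>\<alpha> \<le> 1 / 2\<close>, and exponents
  of at least 2 make the difference positive at 2.\<close>

lemma two_cycle_root_exists:
  fixes \<beta> :: real
  assumes "0 \<le> \<beta>" "\<beta> \<le> 1" "p \<ge> 2" "q \<ge> 2"
  shows "\<exists>s. 1 < s \<and> s < 2 \<and> s - \<beta> = (1 / s) ^ p + (1 / s) ^ q"
proof -
  define f where "f s = s - \<beta> - (1 / s) ^ p - (1 / s) ^ q" for s :: real
  have "(1 / 2 :: real) ^ p \<le> (1 / 2) ^ 2" "(1 / 2 :: real) ^ q \<le> (1 / 2) ^ 2"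
    using assms by (intro power_decreasing; simp)+
  then have f2: "f 2 > 0" using assms by (simp add: f_def power2_eq_square)
  have f1: "f 1 < 0" using assms by (simp add: f_def)
  have "continuous_on {1..2} f"
    unfolding f_def by (intro continuous_intros) auto
  then obtain s where s: "1 \<le> s" "s \<le> 2" "f s = 0"
    using IVT'[of f 1 0 2] f1 f2 by auto
  then have "s \<noteq> 1" "s \<noteq> 2" using f1 f2 by auto
  then show ?thesis using s by (intro exI[of _ s]) (auto simp: f_def)
qed

text \<open>As \<open>s\<close> grows, \<open>s - \<beta>\<close> increases and the powers decrease,
  so the inequality can hold only beyond a root.\<close>

lemma two_cycle_root_less:
  fixes \<beta> s s' :: real
  assumes "0 < s" "0 < s'" and s: "s - \<beta> = (1 / s) ^ p + (1 / s) ^ q"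
    and s': "s' - \<beta> > (1 / s') ^ p + (1 / s') ^ q"
  shows "s < s'"
proof (rule ccontr)
  assume "\<not> s < s'"
  then have "(1 / s) ^ p \<le> (1 / s') ^ p" "(1 / s) ^ q \<le> (1 / s') ^ q"
    using assms by (auto intro!: power_mono divide_left_mono)
  then show False using s s' \<open>\<not> s < s'\<close> by linarith
qed

section \<open>Arcs, strong connectivity and radii of the cycle and the theta digraphs\<close>

lemma path_arcs_upt:
  "k < n \<Longrightarrow> path_arcs (a # [k..<n] @ [b])
    = {(a, k), (n - 1, b)} \<union> {(i, Suc i) |i. k \<le> i \<and> Suc i < n}"
proof (induction "n - k" arbitrary: a k)
  case (Suc m)
  have Cons: "path_arcs (a # [k..<n] @ [b]) = insert (a, k) (path_arcs (k # [Suc k..<n] @ [b]))"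
    using Suc.prems by (simp add: path_arcs_def upt_conv_Cons)
  show ?case
  proof (cases "Suc k < n")
    case True
    then have "path_arcs (k # [Suc k..<n] @ [b])
      = {(k, Suc k), (n - 1, b)} \<union> {(i, Suc i) |i. Suc k \<le> i \<and> Suc i < n}"
      using Suc by (intro Suc.hyps) auto
    moreover have "{(i, Suc i) |i. k \<le> i \<and> Suc i < n}
      = insert (k, Suc k) {(i, Suc i) |i. Suc k \<le> i \<and> Suc i < n}"
      using True by (auto simp: le_less Suc_le_eq)
    ultimately show ?thesis unfolding Cons by auto
  next
    case False
    then have "n = Suc k" using Suc.prems by simp
    then show ?thesis unfolding Cons by (auto simp: path_arcs_def)
  qed
qed simp

text \<open>\<open>d\<close> is a rank that decreases along the unique arc out of each nonzero
  vertex, so every vertex leads to 0, and \<open>reach\<close> leads back.\<close>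

lemma strong_digraphsI:
  fixes d :: "nat \<Rightarrow> nat"
  assumes verts: "pverts G = {0..<n}" and n: "n > 0"
    and arcs: "\<And>a b. (a, b) \<in> parcs G \<Longrightarrow> a < n \<and> b < n \<and> a \<noteq> b"
    and step: "\<And>z. z < n \<Longrightarrow> z \<noteq> 0 \<Longrightarrow> \<exists>z'. parcs G `` {z} = {z'} \<and> d z = Suc (d z')"
    and reach: "\<And>z. z < n \<Longrightarrow> (0, z) \<in> (parcs G)\<^sup>*"
  shows "G \<in> strong_digraphs n"
proof -
  have "parcs G \<subseteq> {0..<n} \<times> {0..<n}" using arcs by auto
  then have "finite (parcs G)" by (rule finite_subset) simp
  then interpret pair_digraph G
    by unfold_locales (use verts arcs in auto)
  have to_0: "(z, 0) \<in> (parcs G)\<^sup>*" if "z < n" for z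
    using that
  proof (induction "d z" arbitrary: z rule: less_induct)
    case less
    show ?case
    proof (cases "z = 0")
      case False
      then obtain z' where z': "parcs G `` {z} = {z'}" "d z = Suc (d z')"
        using step less.prems by blast
      then have "(z, z') \<in> parcs G" by auto
      then show ?thesis using less.hyps[of z'] z' arcs by (auto intro: converse_rtrancl_into_rtrancl)
    qed simp
  qed
  have "strongly_connected (with_proj G)"
    unfolding strongly_connected_def
    using n verts rtrancl_trans[OF to_0 reach] by (auto simp: reachable_conv)
  then show ?thesis using pair_digraph_axioms verts by (simp add: strong_digraphs_def order_of_def)
qed

lemma dicycle_strong:
  assumes n: "n \<ge> 2"
  shows "dicycle n \<in> strong_digraphs n"
proof (rule strong_digraphsI[where d = "\<lambda>z. if z = 0 then 0 else n - z"])
  fix z assume z: "z < n"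
  have out: "parcs (dicycle n) `` {z} = {Suc z mod n}" using z by (auto simp: dicycle_def)
  then show "\<exists>z'. parcs (dicycle n) `` {z} = {z'}
    \<and> (if z = 0 then 0 else n - z) = Suc (if z' = 0 then 0 else n - z')" if "z \<noteq> 0"
    using z that by (cases "Suc z = n") auto
  show "(0, z) \<in> (parcs (dicycle n))\<^sup>*" using z
  proof (induction z)
    case (Suc z)
    then have "(z, Suc z) \<in> parcs (dicycle n)" by (auto simp: dicycle_def)
    then show ?case using Suc by (auto intro: rtrancl_into_rtrancl)
  qed simp
qed (use n in \<open>auto simp: dicycle_def mod_Suc\<close>)

lemma card_out_dicycle:
  assumes "z < n"
  shows "card (parcs (dicycle n) `` {z}) = 1"
proof -
  have "parcs (dicycle n) `` {z} = {Suc z mod n}" using assms by (auto simp: dicycle_def)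
  then show ?thesis by simp
qed

lemma reach_along_path:
  assumes "(a, k) \<in> r\<^sup>*" "\<And>i. k \<le> i \<Longrightarrow> Suc i < n \<Longrightarrow> (i, Suc i) \<in> r" "k \<le> z" "z < (n :: nat)"
  shows "(a, z) \<in> r\<^sup>*"
  using assms(3,4)
proof (induction z rule: dec_induct)
  case base
  show ?case by fact
next
  case (step m)
  then show ?case using assms(2)[of m] by (auto intro: rtrancl_into_rtrancl)
qed

lemma parcs_theta_0_1:
  assumes "n \<ge> 5"
  shows "parcs (theta 0 1 (n - 3)) =
    {(0, 1), (0, 2), (2, 1), (1, 3), (n - 1, 0)} \<union> {(i, Suc i) |i. 3 \<le> i \<and> Suc i < n}"
proof -
  have idx: "0 + 1 + (n - 3) + 2 = n" "0 + 1 + 2 = (3::nat)" "0 + 2 = (2::nat)" using assms by auto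
  have lists: "[2..<2::nat] = []" "[2..<3::nat] = [2]" by (simp_all add: upt_rec)
  have short: "path_arcs (0 # [] @ [1::nat]) = {(0, 1)}"
    "path_arcs (0 # [2] @ [1::nat]) = {(0, 2), (2, 1)}" by (auto simp: path_arcs_def)
  have "3 < n" using assms by simp
  then show ?thesis
    unfolding theta_def pair_pre_digraph.simps idx lists short path_arcs_upt[OF \<open>3 < n\<close>] by blast
qed

lemma parcs_theta_1_1:
  assumes "n \<ge> 5"
  shows "parcs (theta 1 1 (n - 4)) =
    {(0, 2), (2, 1), (0, 3), (3, 1), (1, 4), (n - 1, 0)} \<union> {(i, Suc i) |i. 4 \<le> i \<and> Suc i < n}"
proof -
  have idx: "1 + 1 + (n - 4) + 2 = n" "1 + 1 + 2 = (4::nat)" "1 + 2 = (3::nat)" using assms by auto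
  have lists: "[2..<3::nat] = [2]" "[3..<4::nat] = [3]" by (simp_all add: upt_rec)
  have short: "path_arcs (0 # [2] @ [1::nat]) = {(0, 2), (2, 1)}"
    "path_arcs (0 # [3] @ [1::nat]) = {(0, 3), (3, 1)}" by (auto simp: path_arcs_def)
  have "4 < n" using assms by simp
  then show ?thesis
    unfolding theta_def pair_pre_digraph.simps idx lists short path_arcs_upt[OF \<open>4 < n\<close>] by blast
qed

lemma parcs_theta_0_2:
  assumes "n \<ge> 5"
  shows "parcs (theta 0 2 (n - 4)) =
    {(0, 1), (0, 2), (2, 3), (3, 1), (1, 4), (n - 1, 0)} \<union> {(i, Suc i) |i. 4 \<le> i \<and> Suc i < n}"
proof -
  have idx: "0 + 2 = (2::nat)" "2 + (n - 4) + 2 = n" "2 + 2 = (4::nat)" using assms by auto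
  have lists: "[2..<2::nat] = []" "[2..<4::nat] = [2, 3]" by (simp_all add: upt_rec)
  have short: "path_arcs (0 # [] @ [1::nat]) = {(0, 1)}"
    "path_arcs (0 # [2, 3] @ [1::nat]) = {(0, 2), (2, 3), (3, 1)}" by (auto simp: path_arcs_def)
  have "4 < n" using assms by simp
  then show ?thesis
    unfolding theta_def pair_pre_digraph.simps idx lists short path_arcs_upt[OF \<open>4 < n\<close>] by blast
qed

text \<open>One function \<open>d\<close> serves both conclusions: as the rank in
  \<open>strong_digraphsI\<close> and as the exponent of the eigenvector in
  \<open>lambda_alpha_eqI\<close>.\<close>

lemma theta_like_digraph:
  fixes d :: "nat \<Rightarrow> nat"
  assumes verts: "pverts G = {0..<n}" and n: "n > 0"
    and arcs: "\<And>a b. (a, b) \<in> parcs G \<Longrightarrow> a < n \<and> b < n \<and> a \<noteq> b"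
    and d0: "d 0 = 0" and out0: "parcs G `` {0} = {w1, w2}" "w1 \<noteq> w2"
    and step: "\<And>z. z < n \<Longrightarrow> z \<noteq> 0 \<Longrightarrow> \<exists>z'. parcs G `` {z} = {z'} \<and> d z = Suc (d z')"
    and reach: "\<And>z. z < n \<Longrightarrow> (0, z) \<in> (parcs G)\<^sup>*"
  shows "G \<in> strong_digraphs n"
    and "0 \<le> \<alpha> \<Longrightarrow> \<alpha> < 1 \<Longrightarrow> s > 0 \<Longrightarrow> s - \<alpha> / (1 - \<alpha>) = (1 / s) ^ d w1 + (1 / s) ^ d w2
      \<Longrightarrow> lambda_alpha \<alpha> G = \<alpha> + (1 - \<alpha>) * s"
proof -
  show G: "G \<in> strong_digraphs n"
    using strong_digraphsI[of G n d] assms by blast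
  assume a: "0 \<le> \<alpha>" "\<alpha> < 1" and s: "s > 0" "s - \<alpha> / (1 - \<alpha>) = (1 / s) ^ d w1 + (1 / s) ^ d w2"
  interpret pair_digraph G using G by (simp add: strong_digraphs_def)
  interpret strong_pair_digraph G \<alpha> "\<alpha> / (1 - \<alpha>)"
    by unfold_locales (use G a in \<open>auto simp: strong_digraphs_def\<close>)
  show "lambda_alpha \<alpha> G = \<alpha> + (1 - \<alpha>) * s"
    using lambda_alpha_eqI[of 0 d w1 w2 s] verts n d0 out0 step s by simp
qed

context
  fixes n :: nat
  assumes n5: "n \<ge> 5"
begin

lemma theta_0_1:
  shows "theta 0 1 (n - 3) \<in> strong_digraphs n"
    and "0 \<le> \<alpha> \<Longrightarrow> \<alpha> < 1 \<Longrightarrow> s > 0 \<Longrightarrow> s - \<alpha> / (1 - \<alpha>) = (1 / s) ^ (n - 2) + (1 / s) ^ (n - 1)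
      \<Longrightarrow> lambda_alpha \<alpha> (theta 0 1 (n - 3)) = \<alpha> + (1 - \<alpha>) * s"
proof -
  let ?G = "theta 0 1 (n - 3)"
  \<comment> \<open>The distance to 0: the return path runs from 1 through 3 up to
    \<open>n - 1\<close>, and 2 lies one step before 1.\<close>
  define d where "d z = (if z = 0 then 0 else if z = 1 then n - 2 else if z = 2 then n - 1
    else n - z)" for z :: nat
  note R = parcs_theta_0_1[OF n5]
  have verts: "pverts ?G = {0..<n}" using n5 by (auto simp: theta_def)
  have arcs: "a < n \<and> b < n \<and> a \<noteq> b" if "(a, b) \<in> parcs ?G" for a b
    using that n5 unfolding R by auto
  have out0: "parcs ?G `` {0} = {1, 2}" using n5 unfolding R by auto
  have step: "\<exists>z'. parcs ?G `` {z} = {z'} \<and> d z = Suc (d z')" if z: "z < n" "z \<noteq> 0" for z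
  proof -
    consider "z = 1" | "z = 2" | "z \<ge> 3" "Suc z < n" | "Suc z = n" using z by linarith
    then show ?thesis
    proof cases
      case 1
      then have "parcs ?G `` {z} = {3}" using n5 unfolding R by auto
      moreover have "d z = Suc (d 3)" using 1 n5 by (auto simp: d_def)
      ultimately show ?thesis by blast
    next
      case 2
      then have "parcs ?G `` {z} = {1}" using n5 unfolding R by auto
      moreover have "d z = Suc (d 1)" using 2 n5 by (auto simp: d_def)
      ultimately show ?thesis by blast
    next
      case 3
      then have "parcs ?G `` {z} = {Suc z}" using n5 unfolding R by auto
      moreover have "d z = Suc (d (Suc z))" using 3 n5 by (auto simp: d_def)
      ultimately show ?thesis by blast
    next
      case 4
      then have "parcs ?G `` {z} = {0}" using n5 unfolding R by auto
      moreover have "d z = Suc (d 0)" using 4 n5 by (auto simp: d_def)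
      ultimately show ?thesis by blast
    qed
  qed
  have r: "(0, 1) \<in> (parcs ?G)\<^sup>*" "(0, 2) \<in> (parcs ?G)\<^sup>*" "(1, 3) \<in> parcs ?G"
    unfolding R by auto
  have reach: "(0, z) \<in> (parcs ?G)\<^sup>*" if z: "z < n" for z
  proof -
    consider "z = 0" | "z = 1" | "z = 2" | "3 \<le> z" by linarith
    then show ?thesis
    proof cases
      case 4
      show ?thesis
        using reach_along_path[OF rtrancl_into_rtrancl[OF r(1,3)], of n z] 4 z unfolding R by auto
    qed (use r in auto)
  qed
  have "0 < n" "d 0 = 0" "(1 :: nat) \<noteq> 2" using n5 by (auto simp: d_def)
  note * = theta_like_digraph[OF verts this(1) arcs this(2) out0 this(3) step reach]
  show "?G \<in> strong_digraphs n" by (rule *(1))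
  show "0 \<le> \<alpha> \<Longrightarrow> \<alpha> < 1 \<Longrightarrow> s > 0 \<Longrightarrow> s - \<alpha> / (1 - \<alpha>) = (1 / s) ^ (n - 2) + (1 / s) ^ (n - 1)
      \<Longrightarrow> lambda_alpha \<alpha> ?G = \<alpha> + (1 - \<alpha>) * s"
    by (rule *(2)) (auto simp: d_def)
qed

lemma theta_1_1:
  shows "theta 1 1 (n - 4) \<in> strong_digraphs n"
    and "0 \<le> \<alpha> \<Longrightarrow> \<alpha> < 1 \<Longrightarrow> s > 0 \<Longrightarrow> s - \<alpha> / (1 - \<alpha>) = (1 / s) ^ (n - 2) + (1 / s) ^ (n - 2)
      \<Longrightarrow> lambda_alpha \<alpha> (theta 1 1 (n - 4)) = \<alpha> + (1 - \<alpha>) * s"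
proof -
  let ?G = "theta 1 1 (n - 4)"
  \<comment> \<open>The distance to 0: the return path runs from 1 through 4 up to
    \<open>n - 1\<close>, and the twins 2 and 3 both precede 1.\<close>
  define d where "d z = (if z = 0 then 0 else if z = 1 then n - 3 else if z \<in> {2, 3} then n - 2
    else n - z)" for z :: nat
  note R = parcs_theta_1_1[OF n5]
  have verts: "pverts ?G = {0..<n}" using n5 by (auto simp: theta_def)
  have arcs: "a < n \<and> b < n \<and> a \<noteq> b" if "(a, b) \<in> parcs ?G" for a b
    using that n5 unfolding R by auto
  have out0: "parcs ?G `` {0} = {2, 3}" using n5 unfolding R by auto
  have step: "\<exists>z'. parcs ?G `` {z} = {z'} \<and> d z = Suc (d z')" if z: "z < n" "z \<noteq> 0" for z
  proof -
    consider "z = 1" | "z \<in> {2, 3}" | "z \<ge> 4" "Suc z < n" | "Suc z = n"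
      using z by (simp, linarith)
    then show ?thesis
    proof cases
      case 1
      then have "parcs ?G `` {z} = {4}" using n5 unfolding R by auto
      moreover have "d z = Suc (d 4)" using 1 n5 by (auto simp: d_def)
      ultimately show ?thesis by blast
    next
      case 2
      then have "parcs ?G `` {z} = {1}" using n5 unfolding R by auto
      moreover have "d z = Suc (d 1)" using 2 n5 by (auto simp: d_def)
      ultimately show ?thesis by blast
    next
      case 3
      then have "parcs ?G `` {z} = {Suc z}" using n5 unfolding R by auto
      moreover have "d z = Suc (d (Suc z))" using 3 n5 by (auto simp: d_def)
      ultimately show ?thesis by blast
    next
      case 4
      then have "parcs ?G `` {z} = {0}" using n5 unfolding R by auto
      moreover have "d z = Suc (d 0)" using 4 n5 by (auto simp: d_def)
      ultimately show ?thesis by blast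
    qed
  qed
  have r: "(0, 2) \<in> (parcs ?G)\<^sup>*" "(0, 3) \<in> (parcs ?G)\<^sup>*" "(2, 1) \<in> parcs ?G" "(1, 4) \<in> parcs ?G"
    unfolding R by auto
  have r1: "(0, 1) \<in> (parcs ?G)\<^sup>*" using r(1,3) by (rule rtrancl_into_rtrancl)
  have reach: "(0, z) \<in> (parcs ?G)\<^sup>*" if z: "z < n" for z
  proof -
    consider "z = 0" | "z = 1" | "z = 2" | "z = 3" | "4 \<le> z" by linarith
    then show ?thesis
    proof cases
      case 5
      show ?thesis
        using reach_along_path[OF rtrancl_into_rtrancl[OF r1 r(4)], of n z] 5 z unfolding R by auto
    qed (use r r1 in auto)
  qed
  have "0 < n" "d 0 = 0" "(2 :: nat) \<noteq> 3" using n5 by (auto simp: d_def)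
  note * = theta_like_digraph[OF verts this(1) arcs this(2) out0 this(3) step reach]
  show "?G \<in> strong_digraphs n" by (rule *(1))
  show "0 \<le> \<alpha> \<Longrightarrow> \<alpha> < 1 \<Longrightarrow> s > 0 \<Longrightarrow> s - \<alpha> / (1 - \<alpha>) = (1 / s) ^ (n - 2) + (1 / s) ^ (n - 2)
      \<Longrightarrow> lambda_alpha \<alpha> ?G = \<alpha> + (1 - \<alpha>) * s"
    by (rule *(2)) (auto simp: d_def)
qed

lemma theta_0_2:
  shows "theta 0 2 (n - 4) \<in> strong_digraphs n"
    and "0 \<le> \<alpha> \<Longrightarrow> \<alpha> < 1 \<Longrightarrow> s > 0 \<Longrightarrow> s - \<alpha> / (1 - \<alpha>) = (1 / s) ^ (n - 3) + (1 / s) ^ (n - 1)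
      \<Longrightarrow> lambda_alpha \<alpha> (theta 0 2 (n - 4)) = \<alpha> + (1 - \<alpha>) * s"
proof -
  let ?G = "theta 0 2 (n - 4)"
  \<comment> \<open>The distance to 0: as before along the return path, with the detour from 2
    through 3 to 1 in front.\<close>
  define d where "d z = (if z = 0 then 0 else if z = 1 then n - 3 else if z = 2 then n - 1
    else if z = 3 then n - 2 else n - z)" for z :: nat
  note R = parcs_theta_0_2[OF n5]
  have verts: "pverts ?G = {0..<n}" using n5 by (auto simp: theta_def)
  have arcs: "a < n \<and> b < n \<and> a \<noteq> b" if "(a, b) \<in> parcs ?G" for a b
    using that n5 unfolding R by auto
  have out0: "parcs ?G `` {0} = {1, 2}" using n5 unfolding R by auto
  have step: "\<exists>z'. parcs ?G `` {z} = {z'} \<and> d z = Suc (d z')" if z: "z < n" "z \<noteq> 0" for z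
  proof -
    consider "z = 1" | "z = 2" | "z = 3" | "z \<ge> 4" "Suc z < n" | "Suc z = n" using z by linarith
    then show ?thesis
    proof cases
      case 1
      then have "parcs ?G `` {z} = {4}" using n5 unfolding R by auto
      moreover have "d z = Suc (d 4)" using 1 n5 by (auto simp: d_def)
      ultimately show ?thesis by blast
    next
      case 2
      then have "parcs ?G `` {z} = {3}" using n5 unfolding R by auto
      moreover have "d z = Suc (d 3)" using 2 n5 by (auto simp: d_def)
      ultimately show ?thesis by blast
    next
      case 3
      then have "parcs ?G `` {z} = {1}" using n5 unfolding R by auto
      moreover have "d z = Suc (d 1)" using 3 n5 by (auto simp: d_def)
      ultimately show ?thesis by blast
    next
      case 4
      then have "parcs ?G `` {z} = {Suc z}" using n5 unfolding R by auto
      moreover have "d z = Suc (d (Suc z))" using 4 n5 by (auto simp: d_def)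
      ultimately show ?thesis by blast
    next
      case 5
      then have "parcs ?G `` {z} = {0}" using n5 unfolding R by auto
      moreover have "d z = Suc (d 0)" using 5 n5 by (auto simp: d_def)
      ultimately show ?thesis by blast
    qed
  qed
  have r: "(0, 1) \<in> (parcs ?G)\<^sup>*" "(0, 2) \<in> (parcs ?G)\<^sup>*" "(2, 3) \<in> parcs ?G" "(1, 4) \<in> parcs ?G"
    unfolding R by auto
  have r3: "(0, 3) \<in> (parcs ?G)\<^sup>*" using r(2,3) by (rule rtrancl_into_rtrancl)
  have reach: "(0, z) \<in> (parcs ?G)\<^sup>*" if z: "z < n" for z
  proof -
    consider "z = 0" | "z = 1" | "z = 2" | "z = 3" | "4 \<le> z" by linarith
    then show ?thesis
    proof cases
      case 5
      show ?thesis
        using reach_along_path[OF rtrancl_into_rtrancl[OF r(1,4)], of n z] 5 z unfolding R by auto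
    qed (use r r3 in auto)
  qed
  have "0 < n" "d 0 = 0" "(1 :: nat) \<noteq> 2" using n5 by (auto simp: d_def)
  note * = theta_like_digraph[OF verts this(1) arcs this(2) out0 this(3) step reach]
  show "?G \<in> strong_digraphs n" by (rule *(1))
  show "0 \<le> \<alpha> \<Longrightarrow> \<alpha> < 1 \<Longrightarrow> s > 0 \<Longrightarrow> s - \<alpha> / (1 - \<alpha>) = (1 / s) ^ (n - 3) + (1 / s) ^ (n - 1)
      \<Longrightarrow> lambda_alpha \<alpha> ?G = \<alpha> + (1 - \<alpha>) * s"
    by (rule *(2)) (auto simp: d_def)
qed

end

section \<open>Possible radii and the final ranking\<close>

lemma strong_digraph_lambda_cases:
  assumes G: "G \<in> strong_digraphs n" and n5: "n \<ge> 5" and a: "0 \<le> \<alpha>" "\<alpha> < 1"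
    and s2: "s2 > 0" "s2 - \<alpha> / (1 - \<alpha>) = (1 / s2) ^ (n - 2) + (1 / s2) ^ (n - 1)"
    and s3: "s3 > 0" "s3 - \<alpha> / (1 - \<alpha>) = (1 / s3) ^ (n - 2) + (1 / s3) ^ (n - 2)"
    and s4: "1 < s4" "s4 \<le> 2" "s4 - \<alpha> / (1 - \<alpha>) = (1 / s4) ^ (n - 3) + (1 / s4) ^ (n - 1)"
  shows "lambda_alpha \<alpha> G = 1 \<and> digraph_iso (with_proj G) (with_proj (dicycle n))
    \<or> lambda_alpha \<alpha> G \<in> {\<alpha> + (1 - \<alpha>) * s2, \<alpha> + (1 - \<alpha>) * s3}
    \<or> \<alpha> + (1 - \<alpha>) * s4 \<le> lambda_alpha \<alpha> G"
proof -
  interpret pair_digraph G using G by (simp add: strong_digraphs_def)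
  interpret strong_pair_digraph G \<alpha> "\<alpha> / (1 - \<alpha>)"
    by unfold_locales (use G a in \<open>auto simp: strong_digraphs_def\<close>)
  have order: "order_of G = n" using G by (simp add: strong_digraphs_def)
  show ?thesis
  proof (cases "\<forall>z \<in> pverts G. card (out z) = 1")
    case True
    then show ?thesis using lambda_alpha_eq_1 digraph_iso_dicycle order by blast
  next
    case False
    then obtain v where v: "v \<in> pverts G" "card (out v) \<noteq> 1" by blast
    moreover have "card (out v) \<noteq> 0"
      using out_nonempty[OF v(1)] finite_out order n5 by simp
    ultimately obtain w1 w2 where w: "w1 \<in> out v" "w2 \<in> out v" "w1 \<noteq> w2"
      by (metis card_le_Suc0_iff_eq finite_out le_zero_eq le_Suc_eq One_nat_def)
    show ?thesis
    proof (cases "\<alpha> + (1 - \<alpha>) * s4 \<le> lambda_alpha \<alpha> G")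
      case False
      interpret small_radius_digraph G \<alpha> "\<alpha> / (1 - \<alpha>)" n s4
        by unfold_locales (use order n5 s4 False in auto)
      show ?thesis using lambda_alpha_cases[OF w s2 s3] by blast
    qed blast
  qed
qed

theorem theorem3p5:
  fixes \<alpha> :: real and n :: nat
  assumes "0 \<le> \<alpha>" and "\<alpha> \<le> 1 / 2" and "n \<ge> 5"
  shows "attains_kth_min (lambda_alpha \<alpha>) (strong_digraphs n) 1 (dicycle n)
    \<and> (\<forall>G \<in> strong_digraphs n. attains_kth_min (lambda_alpha \<alpha>) (strong_digraphs n) 1 G
          \<longrightarrow> digraph_iso (with_proj G) (with_proj (dicycle n)))
    \<and> attains_kth_min (lambda_alpha \<alpha>) (strong_digraphs n) 2 (theta 0 1 (n - 3))
    \<and> attains_kth_min (lambda_alpha \<alpha>) (strong_digraphs n) 3 (theta 1 1 (n - 4))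
    \<and> attains_kth_min (lambda_alpha \<alpha>) (strong_digraphs n) 4 (theta 0 2 (n - 4))"
proof -
  note a = assms(1,2) and n5 = assms(3)
  define \<beta> where "\<beta> = \<alpha> / (1 - \<alpha>)"
  have \<beta>: "0 \<le> \<beta>" "\<beta> \<le> 1" using a by (auto simp: \<beta>_def field_simps)
  have nb: "2 \<le> n - 1" "2 \<le> n - 2" "2 \<le> n - 3" using n5 by auto
  obtain s2 where s2: "1 < s2" "s2 < 2" "s2 - \<beta> = (1 / s2) ^ (n - 2) + (1 / s2) ^ (n - 1)"
    using two_cycle_root_exists[OF \<beta> nb(2) nb(1)] by blast
  obtain s3 where s3: "1 < s3" "s3 < 2" "s3 - \<beta> = (1 / s3) ^ (n - 2) + (1 / s3) ^ (n - 2)"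
    using two_cycle_root_exists[OF \<beta> nb(2) nb(2)] by blast
  obtain s4 where s4: "1 < s4" "s4 < 2" "s4 - \<beta> = (1 / s4) ^ (n - 3) + (1 / s4) ^ (n - 1)"
    using two_cycle_root_exists[OF \<beta> nb(3) nb(1)] by blast
  have less23: "s2 < s3"
  proof (rule two_cycle_root_less)
    \<comment> \<open>Raising one exponent lowers the right-hand side at \<open>s3\<close>, so
      \<open>s3\<close> lies beyond the root \<open>s2\<close>.\<close>
    have "(1 / s3) ^ (n - 1) < (1 / s3) ^ (n - 2)"
      using s3 n5 by (intro power_strict_decreasing) auto
    then show "s3 - \<beta> > (1 / s3) ^ (n - 2) + (1 / s3) ^ (n - 1)" using s3(3) by simp
  qed (use s2 s3 in auto)
  have less34: "s3 < s4"
  proof (rule two_cycle_root_less)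
    define t where "t = 1 / s4"
    have t: "0 < t" "t < 1" using s4 by (auto simp: t_def)
    have "n - 2 = Suc (n - 3)" "n - 1 = Suc (Suc (n - 3))" using n5 by auto
    then have tn: "t ^ (n - 2) = t * t ^ (n - 3)" "t ^ (n - 1) = t * (t * t ^ (n - 3))"
      by (metis power_Suc)+
    \<comment> \<open>The comparison of exponents is \<open>2 * t < 1 + t * t\<close>, multiplied by
      \<open>t ^ (n - 3)\<close>.\<close>
    have "0 < t ^ (n - 3) * (1 - t)\<^sup>2" using t by simp
    then have "t ^ (n - 2) + t ^ (n - 2) < t ^ (n - 3) + t ^ (n - 1)"
      unfolding tn by (simp add: power2_eq_square algebra_simps)
    then show "s4 - \<beta> > (1 / s4) ^ (n - 2) + (1 / s4) ^ (n - 2)"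
      using s4(3) by (simp add: t_def)
  qed (use s3 s4 in auto)
  define f where "f = lambda_alpha \<alpha>"
  define S where "S = strong_digraphs n"
  define l where "l s = \<alpha> + (1 - \<alpha>) * s" for s
  have l_mono: "l s < l s'" if "s < s'" for s s'
    using that a by (simp add: l_def)
  have l1: "l 1 = 1" by (simp add: l_def)
  have order: "1 < l s2" "l s2 < l s3" "l s3 < l s4"
    using l_mono[of 1 s2] l1 l_mono s2 less23 less34 by auto
  have C: "dicycle n \<in> S" unfolding S_def using n5 by (intro dicycle_strong) simp
  have fC: "f (dicycle n) = 1"
  proof -
    interpret pair_digraph "dicycle n" using C by (simp add: S_def strong_digraphs_def)
    interpret strong_pair_digraph "dicycle n" \<alpha> \<beta>
      by unfold_locales (use C a in \<open>auto simp: S_def strong_digraphs_def \<beta>_def\<close>)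
    have "card (parcs (dicycle n) `` {z}) = 1" if "z \<in> pverts (dicycle n)" for z
      using card_out_dicycle[of z n] that by (simp add: dicycle_def)
    then show ?thesis unfolding f_def by (rule lambda_alpha_eq_1)
  qed
  have T: "theta 0 1 (n - 3) \<in> S" "theta 1 1 (n - 4) \<in> S" "theta 0 2 (n - 4) \<in> S"
    using theta_0_1(1)[OF n5] theta_1_1(1)[OF n5] theta_0_2(1)[OF n5] by (auto simp: S_def)
  have fT: "f (theta 0 1 (n - 3)) = l s2" "f (theta 1 1 (n - 4)) = l s3" "f (theta 0 2 (n - 4)) = l s4"
    using theta_0_1(2)[OF n5, of \<alpha> s2] theta_1_1(2)[OF n5, of \<alpha> s3] theta_0_2(2)[OF n5, of \<alpha> s4]
      a s2 s3 s4 by (auto simp: f_def l_def \<beta>_def)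
  have vals_iso: "f G = 1 \<and> digraph_iso (with_proj G) (with_proj (dicycle n))
    \<or> f G \<in> {l s2, l s3} \<or> l s4 \<le> f G" if "G \<in> S" for G
    using strong_digraph_lambda_cases[of G n \<alpha> s2 s3 s4] that n5 a s2 s3 s4
    by (auto simp: f_def S_def l_def \<beta>_def)
  have vals: "f G \<in> {1, l s2, l s3} \<or> l s4 \<le> f G" if "G \<in> S" for G
    using vals_iso[OF that] by blast
  have mem: "{1, l s2, l s3, l s4} \<subseteq> f ` S"
    using C fC T fT by (metis image_eqI insert_subset empty_subsetI)
  \<comment> \<open>No value below \<open>l s4\<close> occurs except the three listed ones, so these
    sets have 0, 1, 2 and 3 elements.\<close>
  have below: "{r \<in> f ` S. r < 1} = {}" "{r \<in> f ` S. r < l s2} = {1}"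
    "{r \<in> f ` S. r < l s3} = {1, l s2}" "{r \<in> f ` S. r < l s4} = {1, l s2, l s3}"
    using vals mem order by fastforce+
  have "digraph_iso (with_proj G) (with_proj (dicycle n))" if G: "G \<in> S" "attains_kth_min f S 1 G" for G
  proof -
    have "finite {r \<in> f ` S. r < f G}" "card {r \<in> f ` S. r < f G} = 0"
      using G by (auto simp: attains_kth_min_def)
    then have "{r \<in> f ` S. r < f G} = {}" by simp
    \<comment> \<open>The value 1 occurs, so a minimizer has value at most 1, which leaves only the
      cycle alternative of \<open>vals_iso\<close>.\<close>
    then have "\<not> 1 < f G" using mem by blast
    then show ?thesis using vals_iso[OF G(1)] order by auto
  qed
  moreover have "attains_kth_min f S 1 (dicycle n)" "attains_kth_min f S 2 (theta 0 1 (n - 3))"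
    "attains_kth_min f S 3 (theta 1 1 (n - 4))" "attains_kth_min f S 4 (theta 0 2 (n - 4))"
    unfolding attains_kth_min_def fC fT below using C T order by auto
  ultimately show ?thesis unfolding f_def S_def by blast
qed

end
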